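(* There exist universal constants $C_1,C_2>0$ such that for every $n$, $$K_n\leq C_1Q_n\leq C_2R_n.$$
   Context: A probability measure on $\mathbb{R}^n$ is log-concave if it has a density of the form $\exp(-H)$ with $H:\mathbb{R}^n\to\mathbb{R}\cup\{\infty\}$ convex. A log-concave measure (or a random vector with that law) is isotropic if its barycenter is the origin and its covariance matrix is the identity. The constant $K_n\ge0$ is defined by $$K_n^2=\sup_X\sup_{\theta\in S^{n-1}}\sum_{i,j=1}^n\left(\mathbb{E}[X_iX_j\langle X,\theta\rangle]\right)^2,$$ where $X$ runs over all isotropic log-concave random vectors in $\mathbb{R}^n$ and $S^{n-1}$ is the Euclidean unit sphere. The constant $Q_n\ge0$ is defined by $$Q_n^2=\sup_{X,Q}\frac{\mathrm{Var}[Q(X)]}{\mathbb{E}\left[|\nabla Q(X)|^2\right]},$$ where $X$ runs over all isotropic log-concave random vectors in $\mathbb{R}^n$ and $Q$ over all (nonzero) quadratic forms on $\mathbb{R}^n$. The constant $R_n$ is defined by $$R_n^{-1}=\inf_{\mu,E}\frac{\mu^+(E)}{\mu(E)},$$ where $\mu$ runs over all isotropic log-concave measures on $\mathbb{R}^n$ and $E$ over all ellipsoids in $\mathbb{R}^n$ with $0<\mu(E)\le\frac12$. Here $\mu^+(E)=\liminf_{\varepsilon\to0^+}\frac{\mu(E_\varepsilon)-\mu(E)}{\varepsilon}$ with $E_\varepsilon=\{x\in\mathbb{R}^n:\exists y\in E,\ |x-y|\le\varepsilon\}$. *)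

theory Defs
  imports "HOL-Probability.Probability"
begin

text \<open>
  The statement compares constants uniformly in the dimension, so the dimension has to be a
  natural number rather than a type: $\mathbb{R}^n$ is rendered as the space of extensional
  functions on \<open>{..<n}\<close>, with Lebesgue measure \<open>Pi\<^sub>M {..<n} (\<lambda>_. lborel)\<close>. As extensional functions
  are not closed under pointwise operations, linear combinations are wrapped in \<open>\<lambda>i\<in>{..<n}\<close>.
\<close>

definition Rn :: "nat \<Rightarrow> (nat \<Rightarrow> real) set" where
  "Rn n = {..<n} \<rightarrow>\<^sub>E UNIV"

definition lebesgue_Rn :: "nat \<Rightarrow> (nat \<Rightarrow> real) measure" where
  "lebesgue_Rn n = Pi\<^sub>M {..<n} (\<lambda>_. lborel)"

definition inner_Rn :: "nat \<Rightarrow> (nat \<Rightarrow> real) \<Rightarrow> (nat \<Rightarrow> real) \<Rightarrow> real" where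
  "inner_Rn n x y = (\<Sum>i<n. x i * y i)"

definition dist_Rn :: "nat \<Rightarrow> (nat \<Rightarrow> real) \<Rightarrow> (nat \<Rightarrow> real) \<Rightarrow> real" where
  "dist_Rn n x y = L2_set (\<lambda>i. x i - y i) {..<n}"

definition sphere_Rn :: "nat \<Rightarrow> (nat \<Rightarrow> real) set" where
  "sphere_Rn n = {\<theta> \<in> Rn n. L2_set \<theta> {..<n} = 1}"

text \<open>Convex functions with values in \<open>\<real> \<union> {\<infinity>}\<close>; note that \<open>0 * \<infinity> = 0\<close> in \<^typ>\<open>ereal\<close>.\<close>

definition convex_Rn :: "nat \<Rightarrow> ((nat \<Rightarrow> real) \<Rightarrow> ereal) \<Rightarrow> bool" where
  "convex_Rn n H \<longleftrightarrow>
     (\<forall>x\<in>Rn n. H x \<noteq> -\<infinity>) \<and>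
     (\<forall>x\<in>Rn n. \<forall>y\<in>Rn n. \<forall>t\<in>{0..1}.
        H (\<lambda>i\<in>{..<n}. (1 - t) * x i + t * y i) \<le> ereal (1 - t) * H x + ereal t * H y)"

text \<open>$e^{-h}$ for $h \in \mathbb{R} \cup \{\infty\}$\<close>

definition exp_uminus :: "ereal \<Rightarrow> ennreal" where
  "exp_uminus h = (if h = \<infinity> then 0 else ennreal (exp (- real_of_ereal h)))"

definition log_concave :: "nat \<Rightarrow> (nat \<Rightarrow> real) measure \<Rightarrow> bool" where
  "log_concave n M \<longleftrightarrow>
     prob_space M \<and>
     (\<exists>H. H \<in> borel_measurable (lebesgue_Rn n) \<and> convex_Rn n H \<and>
          M = density (lebesgue_Rn n) (\<lambda>x. exp_uminus (H x)))"

definition barycenter :: "(nat \<Rightarrow> real) measure \<Rightarrow> nat \<Rightarrow> real" where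
  "barycenter M i = prob_space.expectation M (\<lambda>x. x i)"

definition covariance :: "(nat \<Rightarrow> real) measure \<Rightarrow> nat \<Rightarrow> nat \<Rightarrow> real" where
  "covariance M i j =
     prob_space.expectation M (\<lambda>x. (x i - barycenter M i) * (x j - barycenter M j))"

text \<open>
  No integrability hypothesis is needed: a diagonal covariance of 1 rules out the default value 0
  of a divergent integral, so all coordinates are square integrable.
\<close>

definition isotropic :: "nat \<Rightarrow> (nat \<Rightarrow> real) measure \<Rightarrow> bool" where
  "isotropic n M \<longleftrightarrow>
     (\<forall>i<n. barycenter M i = 0) \<and>
     (\<forall>i<n. \<forall>j<n. covariance M i j = (if i = j then 1 else 0))"

definition isotropic_log_concave :: "nat \<Rightarrow> (nat \<Rightarrow> real) measure set" where
  "isotropic_log_concave n = {M. log_concave n M \<and> isotropic n M}"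

definition quadratic_form :: "nat \<Rightarrow> ((nat \<Rightarrow> real) \<Rightarrow> real) \<Rightarrow> bool" where
  "quadratic_form n Q \<longleftrightarrow>
     (\<exists>A :: nat \<Rightarrow> nat \<Rightarrow> real. \<forall>x\<in>Rn n. Q x = (\<Sum>i<n. \<Sum>j<n. A i j * x i * x j))"

definition gradient :: "((nat \<Rightarrow> real) \<Rightarrow> real) \<Rightarrow> (nat \<Rightarrow> real) \<Rightarrow> nat \<Rightarrow> real" where
  "gradient f x i = deriv (\<lambda>t. f (x(i := t))) (x i)"

text \<open>Nondegenerate closed ellipsoids with arbitrary center \<open>c\<close>.\<close>

definition ellipsoid :: "nat \<Rightarrow> (nat \<Rightarrow> real) set \<Rightarrow> bool" where
  "ellipsoid n E \<longleftrightarrow>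
     (\<exists>c\<in>Rn n. \<exists>A :: nat \<Rightarrow> nat \<Rightarrow> real.
        (\<forall>i<n. \<forall>j<n. A i j = A j i) \<and>
        (\<forall>v\<in>Rn n. (\<exists>i<n. v i \<noteq> 0) \<longrightarrow> (\<Sum>i<n. \<Sum>j<n. A i j * v i * v j) > 0) \<and>
        E = {x \<in> Rn n. (\<Sum>i<n. \<Sum>j<n. A i j * (x i - c i) * (x j - c j)) \<le> 1})"

definition enlargement :: "nat \<Rightarrow> real \<Rightarrow> (nat \<Rightarrow> real) set \<Rightarrow> (nat \<Rightarrow> real) set" where
  "enlargement n \<epsilon> E = {x \<in> Rn n. \<exists>y\<in>E. dist_Rn n x y \<le> \<epsilon>}"

definition boundary_measure :: "nat \<Rightarrow> (nat \<Rightarrow> real) measure \<Rightarrow> (nat \<Rightarrow> real) set \<Rightarrow> ennreal" where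
  "boundary_measure n M E =
     Liminf (at_right 0) (\<lambda>\<epsilon>. ennreal ((measure M (enlargement n \<epsilon> E) - measure M E) / \<epsilon>))"

text \<open>
  The constants take values in \<^typ>\<open>ennreal\<close>, so that suprema and infima are always meaningful.
  All quantities converted by \<^const>\<open>ennreal\<close> are nonnegative. Suprema over random vectors are taken
  over their laws, on which alone the quantities depend.
\<close>

definition ennreal_sqrt :: "ennreal \<Rightarrow> ennreal" where
  "ennreal_sqrt x = (if x = \<infinity> then \<infinity> else ennreal (sqrt (enn2real x)))"

definition K_const :: "nat \<Rightarrow> ennreal" where
  "K_const n = ennreal_sqrt
     (SUP M\<in>isotropic_log_concave n. SUP \<theta>\<in>sphere_Rn n.
        ennreal (\<Sum>i<n. \<Sum>j<n. (prob_space.expectation M (\<lambda>x. x i * x j * inner_Rn n x \<theta>))\<^sup>2))"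

definition Q_const :: "nat \<Rightarrow> ennreal" where
  "Q_const n = ennreal_sqrt
     (SUP M\<in>isotropic_log_concave n. SUP Q\<in>{Q. quadratic_form n Q \<and> (\<exists>x\<in>Rn n. Q x \<noteq> 0)}.
        ennreal (prob_space.variance M Q /
                 prob_space.expectation M (\<lambda>x. (L2_set (gradient Q x) {..<n})\<^sup>2)))"

definition R_const :: "nat \<Rightarrow> ennreal" where
  "R_const n = inverse
     (INF M\<in>isotropic_log_concave n. INF E\<in>{E. ellipsoid n E \<and> 0 < measure M E \<and> measure M E \<le> 1/2}.
        boundary_measure n M E / ennreal (measure M E))"

end

theory Submission
  imports Defs
begin

text \<open>
  Let $\mu$ be an isotropic log-concave law and $Q(x) = \langle Ax, x\rangle$ with $A$ symmetric. By
  isotropy $\mathrm{E}|\nabla Q|^2 = 4 |A|^2$ with the Frobenius norm $|A|$.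

  The bound $K_n \le 2 Q_n$ (\<open>K_const_le\<close>). If $A$ is the matrix of the moments
  $\mathrm{E}[X_i X_j \langle X, \theta\rangle]$, then $|A|^2$ is the covariance of $Q(X)$ with
  $\langle X, \theta\rangle$, a variable of variance $1$. Hence
  $|A|^4 \le \mathrm{Var}[Q(X)] \le 4 Q_n^2 |A|^2$.

  The bound $Q_n \le C R_n$ (\<open>Q_const_le\<close>). Every form is a difference of positive definite ones with
  comparable Frobenius norms (\<open>pos_def_difference\<close>), so let $Q$ be positive definite. Its sublevel sets
  are ellipsoids, but $R_n$ speaks only about those of measure at most $1/2$, that is, about levels
  below the median $m$. If all levels in $(m - l, m)$ have sublevel sets of measure at least $1/4$, then
  integrating the isoperimetric inequality over these levels yields $l \le 4 R_n \mathrm{E}|\nabla Q|$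
  (\<open>pos_def_quad_sd\<close>). It remains to find such an $l$ of the order of the standard deviation of
  $Q(X)$: the distribution of $Q(X)$ must not concentrate below the median at a finer scale than
  it does overall.

  This is a fact about log-concave measures alone (\<open>quad_lower_deviation\<close>). It combines a
  reverse Hoelder inequality and a small ball estimate for the quadratic polynomial $P = Q - m$, and
  both follow from one dilation inequality with absolute constants,
  \[ \mu(|P| > 10^5 \lambda)^{1/10} \le \tfrac87\, \mu(|P| > \lambda) \]
  (\<open>quad_dilation\<close>). The reason for it is that a quadratic polynomial that is large at one end of a
  segment can be small only at few places on the segment. The Prekopa-Leindler inequality converts
  this into the comparison of measures, except that the sets involved are not convex and the good
  places depend on the segment. A version of that inequality is therefore proved in which finitely
  many interpolation parameters share the lower bound (\<open>mixed_prekopa_leindler\<close>). It has the usual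
  proof: on the line by interpolating the quantile functions of the two densities, in higher
  dimension by induction and Fubini's theorem.
\<close>

section \<open>Interpolation of quantile functions on the real line\<close>

text \<open>
  Outer regularity reduces the claim to open sets, and these are countable disjoint unions of
  their components.
\<close>

lemma emeasure_le_lborel_if_intervals:
  fixes N :: "real measure"
  assumes sets: "sets N = sets borel"
    and le: "\<And>C. open C \<Longrightarrow> connected C \<Longrightarrow> emeasure N C \<le> emeasure lborel C"
    and B: "B \<in> sets borel"
  shows "emeasure N B \<le> emeasure lborel B"
proof -
  have opn: "emeasure N U \<le> emeasure lborel U" if U: "open U" for U
  proof -
    let ?C = "components U"
    have op: "open C" if "C \<in> ?C" for C using open_components[OF U that] .
    have pw: "pairwise disjnt ?C"
      using pairwise_disjoint_components by (simp add: disjnt_def pairwise_def)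
    have cnt: "countable ?C" by (rule countable_disjoint_open_subsets[OF op pw])
    have dj: "disjoint_family_on (\<lambda>C. C) ?C"
      using pw by (auto simp: disjoint_family_on_def pairwise_def disjnt_def)
    have "emeasure N U = emeasure N (\<Union>C\<in>?C. C)" by simp
    also have "\<dots> = (\<integral>\<^sup>+C. emeasure N C \<partial>count_space ?C)"
      using op by (intro emeasure_UN_countable cnt dj) (auto simp: sets)
    also have "\<dots> \<le> (\<integral>\<^sup>+C. emeasure lborel C \<partial>count_space ?C)"
      by (intro nn_integral_mono le) (auto intro: op in_components_connected)
    also have "\<dots> = emeasure lborel (\<Union>C\<in>?C. C)"
      using op by (intro emeasure_UN_countable[symmetric] cnt dj) auto
    finally show ?thesis by simp
  qed
  show ?thesis
  proof (rule ennreal_le_epsilon)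
    fix e :: real assume "0 < e"
    obtain U where U: "open U" "B \<subseteq> U" "emeasure lborel (U - B) \<le> e"
      using outer_regular_lborel_le[OF B \<open>0 < e\<close>] by blast
    have "emeasure N B \<le> emeasure N U"
      using U by (intro emeasure_mono) (auto simp: sets)
    also have "\<dots> \<le> emeasure lborel U" by (rule opn[OF U(1)])
    also have "\<dots> = emeasure lborel (B \<union> (U - B))"
      using U(2) by (simp add: Un_absorb1)
    also have "\<dots> \<le> emeasure lborel B + emeasure lborel (U - B)"
      using B U(1) by (intro emeasure_subadditive) auto
    also have "\<dots> \<le> emeasure lborel B + ennreal e"
      using U(3) by (intro add_left_mono) auto
    finally show "emeasure N B \<le> emeasure lborel B + ennreal e" .
  qed
qed

abbreviation unit_interval :: "real measure" where
  "unit_interval \<equiv> restrict_space lborel {0<..<1}"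

text \<open>
  The push-forward by the quantile function \<open>X\<close> brings in the density, which cancels against its
  reciprocal. This integrated form of $X' = 1 / f(X)$ holds without differentiability of \<open>X\<close>.
\<close>

lemma quantile_integral_reciprocal_density:
  assumes [measurable]: "f \<in> borel_measurable borel" "X \<in> borel_measurable unit_interval"
    and X: "distr unit_interval borel X = density lborel (\<lambda>x. ennreal (f x))"
    and f: "\<And>x. 0 \<le> f x" and ab: "a \<le> b"
  shows "(\<integral>\<^sup>+u. indicator {a..b} (X u) * ennreal (1 / f (X u)) \<partial>unit_interval) \<le> ennreal (b - a)"
proof -
  have "(\<integral>\<^sup>+u. indicator {a..b} (X u) * ennreal (1 / f (X u)) \<partial>unit_interval)
      = (\<integral>\<^sup>+x. indicator {a..b} x * ennreal (1 / f x) \<partial>distr unit_interval borel X)"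
    by (subst nn_integral_distr) auto
  also have "\<dots> = (\<integral>\<^sup>+x. ennreal (f x) * (indicator {a..b} x * ennreal (1 / f x)) \<partial>lborel)"
    unfolding X by (subst nn_integral_density) auto
  also have "\<dots> \<le> (\<integral>\<^sup>+x. indicator {a..b} x \<partial>lborel)"
  proof (intro nn_integral_mono)
    fix x :: real
    have "ennreal (f x) * ennreal (1 / f x) \<le> 1"
      using f[of x] by (auto simp: ennreal_mult[symmetric])
    then show "ennreal (f x) * (indicator {a..b} x * ennreal (1 / f x)) \<le> indicator {a..b} x"
      by (auto simp: indicator_def)
  qed
  also have "\<dots> = ennreal (b - a)" using ab by simp
  finally show ?thesis .
qed

text \<open>
  Formally, the monotone function $s = (1-t) X + t Y$ has the derivative
  $(1-t) / f(X) + t / k(Y)$, which is at least $f(X)^{t-1} k(Y)^{-t}$ by the weighted inequality of the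
  arithmetic and geometric means. The integral of this derivative over the preimage of the interval
  \<open>C\<close> is estimated by the spread of \<open>X\<close> and \<open>Y\<close> on the preimage; by monotonicity these spreads, with
  weights $1-t$ and $t$, add up to at most the length of \<open>C\<close>.
\<close>

lemma quantile_interpolation_interval:
  assumes [measurable]: "f \<in> borel_measurable borel" "X \<in> borel_measurable unit_interval"
    "k \<in> borel_measurable borel" "Y \<in> borel_measurable unit_interval"
    and X: "distr unit_interval borel X = density lborel (\<lambda>x. ennreal (f x))"
    and Y: "distr unit_interval borel Y = density lborel (\<lambda>x. ennreal (k x))"
    and f: "\<And>x. 0 \<le> f x" and k: "\<And>x. 0 \<le> k x"
    and mX: "mono_on {0<..<1} X" and mY: "mono_on {0<..<1} Y"
    and t: "0 < t" "t < 1" and C: "open C" "connected C"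
  shows "(\<integral>\<^sup>+u. indicator C ((1 - t) * X u + t * Y u) *
           ennreal (f (X u) powr (t - 1) * k (Y u) powr (- t)) \<partial>unit_interval) \<le> emeasure lborel C"
proof -
  define J where "J = {u\<in>{0<..<1}. (1 - t) * X u + t * Y u \<in> C}"
  consider "emeasure lborel C = \<infinity>" | "J = {}" | "emeasure lborel C < \<infinity>" "J \<noteq> {}"
    using top.not_eq_extremum by fastforce
  then show ?thesis
  proof cases
    case 1 then show ?thesis by simp
  next
    case 2
    then have "(\<integral>\<^sup>+u. indicator C ((1 - t) * X u + t * Y u) *
           ennreal (f (X u) powr (t - 1) * k (Y u) powr (- t)) \<partial>unit_interval) = (\<integral>\<^sup>+u. 0 \<partial>unit_interval)"
      by (intro nn_integral_cong) (auto simp: J_def space_restrict_space indicator_def)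
    then show ?thesis by simp
  next
    case 3
    define L where "L = measure lborel C"
    have L: "emeasure lborel C = ennreal L"
      using 3 by (simp add: L_def emeasure_eq_ennreal_measure)
    have L0: "0 \<le> L" by (simp add: L_def)
    have diam: "q - p \<le> L" if "p \<in> C" "q \<in> C" for p q
    proof (cases "p \<le> q")
      case True
      have "ennreal (q - p) = emeasure lborel {p..q}" using True by simp
      also have "\<dots> \<le> emeasure lborel C"
        using connected_contains_Icc[OF C(2) that] C(1) by (intro emeasure_mono) auto
      finally show ?thesis using L L0 by simp
    next
      case False then show ?thesis using L0 by simp
    qed
    \<comment> \<open>All four points lie between the smallest and the largest of them, where \<open>X\<close> and \<open>Y\<close> vary most.\<close>
    have key: "(1 - t) * (X u1 - X u2) + t * (Y u3 - Y u4) \<le> L"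
      if "u1 \<in> J" "u2 \<in> J" "u3 \<in> J" "u4 \<in> J" for u1 u2 u3 u4
    proof -
      let ?v = "max (max u1 u2) (max u3 u4)" and ?u = "min (min u1 u2) (min u3 u4)"
      have uv: "?u \<in> J" "?v \<in> J" using that by (auto simp: max_def min_def)
      have I: "u1 \<in> {0<..<1}" "u2 \<in> {0<..<1}" "u3 \<in> {0<..<1}" "u4 \<in> {0<..<1}"
        "?u \<in> {0<..<1}" "?v \<in> {0<..<1}" using that uv unfolding J_def by blast+
      have "X u1 \<le> X ?v" "X ?u \<le> X u2" "Y u3 \<le> Y ?v" "Y ?u \<le> Y u4"
        by (rule mono_onD[OF mX] mono_onD[OF mY]; (rule I)?; simp)+
      then have "(1 - t) * (X u1 - X u2) + t * (Y u3 - Y u4) \<le> (1 - t) * (X ?v - X ?u) + t * (Y ?v - Y ?u)"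
        using t by (intro add_mono mult_left_mono) auto
      also have "\<dots> = ((1 - t) * X ?v + t * Y ?v) - ((1 - t) * X ?u + t * Y ?u)"
        by (simp add: algebra_simps)
      also have "\<dots> \<le> L" using uv unfolding J_def by (intro diam) blast+
      finally show ?thesis .
    qed
    obtain u0 where u0: "u0 \<in> J" using 3 by auto
    have Xd: "X u - X v \<le> L / (1 - t)" and Yd: "Y u - Y v \<le> L / t" if "u \<in> J" "v \<in> J" for u v
      using key[of u v u0 u0] key[of u0 u0 u v] that u0 t by (auto simp: field_simps)
    have bX: "bdd_above (X ` J)" "bdd_below (X ` J)" and bY: "bdd_above (Y ` J)" "bdd_below (Y ` J)"
    proof -
      show "bdd_above (X ` J)" using Xd[OF _ u0] by (intro bdd_aboveI2[of _ _ "X u0 + L / (1 - t)"]) (auto simp: algebra_simps)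
      show "bdd_below (X ` J)" using Xd[OF u0] by (intro bdd_belowI2[of _ "X u0 - L / (1 - t)"]) (auto simp: algebra_simps)
      show "bdd_above (Y ` J)" using Yd[OF _ u0] by (intro bdd_aboveI2[of _ _ "Y u0 + L / t"]) (auto simp: algebra_simps)
      show "bdd_below (Y ` J)" using Yd[OF u0] by (intro bdd_belowI2[of _ "Y u0 - L / t"]) (auto simp: algebra_simps)
    qed
    define a where "a = (INF u\<in>J. X u)"
    define b where "b = (SUP u\<in>J. X u)"
    define c where "c = (INF u\<in>J. Y u)"
    define d where "d = (SUP u\<in>J. Y u)"
    have inX: "X u \<in> {a..b}" and inY: "Y u \<in> {c..d}" if "u \<in> J" for u
      using that bX bY by (auto simp: a_def b_def c_def d_def intro: cINF_lower cSUP_upper)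
    have ab: "a \<le> b" and cd: "c \<le> d" using inX[OF u0] inY[OF u0] by auto
    have "(1 - t) * (b - a) + t * (d - c) \<le> L"
    proof -
      have s1: "b \<le> (L - t * (Y u3 - Y u4)) / (1 - t) + X u2" if "u2 \<in> J" "u3 \<in> J" "u4 \<in> J" for u2 u3 u4
        unfolding b_def using key[OF _ that] t \<open>J \<noteq> {}\<close>
        by (intro cSUP_least) (auto simp: field_simps)
      have s2: "b - (L - t * (Y u3 - Y u4)) / (1 - t) \<le> a" if "u3 \<in> J" "u4 \<in> J" for u3 u4
        unfolding a_def using s1[OF _ that] t \<open>J \<noteq> {}\<close>
        by (intro cINF_greatest) (auto simp: algebra_simps)
      have s3: "d \<le> (L - (1 - t) * (b - a)) / t + Y u4" if "u4 \<in> J" for u4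
        unfolding d_def using s2[OF _ that] t \<open>J \<noteq> {}\<close>
        by (intro cSUP_least) (auto simp: field_simps)
      have s4: "d - (L - (1 - t) * (b - a)) / t \<le> c"
        unfolding c_def using s3 t \<open>J \<noteq> {}\<close>
        by (intro cINF_greatest) (auto simp: algebra_simps)
      then show ?thesis using t by (auto simp: field_simps)
    qed
    have amgm: "f x powr (t - 1) * k y powr (- t) \<le> (1 - t) * (1 / f x) + t * (1 / k y)" for x y
    proof (cases "f x = 0 \<or> k y = 0")
      case True then show ?thesis using f[of x] k[of y] t by auto
    next
      case False
      then have "(1 / f x) powr (1 - t) * (1 / k y) powr t \<le> (1 - t) * (1 / f x) + t * (1 / k y)"
        using f[of x] k[of y] t by (intro Youngs_inequality_0) auto
      moreover have "(1 / f x) powr (1 - t) = f x powr (t - 1)"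
        using powr_minus_divide[of "f x" "1 - t"] f[of x] by (simp add: powr_divide)
      moreover have "(1 / k y) powr t = k y powr (- t)"
        using powr_minus_divide[of "k y" "t"] k[of y] by (simp add: powr_divide)
      ultimately show ?thesis by simp
    qed
    have "(\<integral>\<^sup>+u. indicator C ((1 - t) * X u + t * Y u) *
           ennreal (f (X u) powr (t - 1) * k (Y u) powr (- t)) \<partial>unit_interval)
      \<le> (\<integral>\<^sup>+u. ennreal (1 - t) * (indicator {a..b} (X u) * ennreal (1 / f (X u))) +
              ennreal t * (indicator {c..d} (Y u) * ennreal (1 / k (Y u))) \<partial>unit_interval)"
    proof (intro nn_integral_mono)
      fix u assume "u \<in> space unit_interval"
      then have u: "u \<in> {0<..<1}" by (simp add: space_restrict_space)
      show "indicator C ((1 - t) * X u + t * Y u) *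
           ennreal (f (X u) powr (t - 1) * k (Y u) powr (- t))
        \<le> ennreal (1 - t) * (indicator {a..b} (X u) * ennreal (1 / f (X u))) +
              ennreal t * (indicator {c..d} (Y u) * ennreal (1 / k (Y u)))"
      proof (cases "u \<in> J")
        case True
        then have C': "(1 - t) * X u + t * Y u \<in> C" by (simp add: J_def)
        have "ennreal (f (X u) powr (t - 1) * k (Y u) powr (- t))
           \<le> ennreal ((1 - t) * (1 / f (X u)) + t * (1 / k (Y u)))"
          by (intro ennreal_leI amgm)
        also have "\<dots> = ennreal (1 - t) * ennreal (1 / f (X u)) + ennreal t * ennreal (1 / k (Y u))"
          using t f[of "X u"] k[of "Y u"] by (simp add: ennreal_mult[symmetric] ennreal_plus[symmetric] del: ennreal_plus)
        finally show ?thesis using C' inX[OF True] inY[OF True] by simp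
      next
        case False
        then show ?thesis using u by (simp add: J_def)
      qed
    qed
    also have "\<dots> = ennreal (1 - t) * (\<integral>\<^sup>+u. indicator {a..b} (X u) * ennreal (1 / f (X u)) \<partial>unit_interval)
        + ennreal t * (\<integral>\<^sup>+u. indicator {c..d} (Y u) * ennreal (1 / k (Y u)) \<partial>unit_interval)"
      by (subst nn_integral_add) (auto simp: nn_integral_cmult)
    also have "\<dots> \<le> ennreal (1 - t) * ennreal (b - a) + ennreal t * ennreal (d - c)"
      by (intro add_mono mult_left_mono quantile_integral_reciprocal_density X Y f k ab cd) auto
    also have "\<dots> = ennreal ((1 - t) * (b - a) + t * (d - c))"
      using t ab cd by (simp add: ennreal_mult[symmetric] ennreal_plus[symmetric] del: ennreal_plus)
    also have "\<dots> \<le> ennreal L" using \<open>(1 - t) * (b - a) + t * (d - c) \<le> L\<close> by (rule ennreal_leI)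
    finally show ?thesis by (simp add: L)
  qed
qed

lemma quantile_interpolation:
  assumes [measurable]: "f \<in> borel_measurable borel" "X \<in> borel_measurable unit_interval"
    "k \<in> borel_measurable borel" "Y \<in> borel_measurable unit_interval" "r \<in> borel_measurable borel"
    and X: "distr unit_interval borel X = density lborel (\<lambda>x. ennreal (f x))"
    and Y: "distr unit_interval borel Y = density lborel (\<lambda>x. ennreal (k x))"
    and f: "\<And>x. 0 \<le> f x" and k: "\<And>x. 0 \<le> k x"
    and mX: "mono_on {0<..<1} X" and mY: "mono_on {0<..<1} Y"
    and t: "0 < t" "t < 1"
  shows "(\<integral>\<^sup>+u. r ((1 - t) * X u + t * Y u) *
           ennreal (f (X u) powr (t - 1) * k (Y u) powr (- t)) \<partial>unit_interval) \<le> (\<integral>\<^sup>+s. r s \<partial>lborel)"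
proof -
  define w where "w u = ennreal (f (X u) powr (t - 1) * k (Y u) powr (- t))" for u
  have [measurable]: "w \<in> borel_measurable unit_interval" unfolding w_def by measurable
  define N where "N = distr (density unit_interval w) borel (\<lambda>u. (1 - t) * X u + t * Y u)"
  have N: "emeasure N B = (\<integral>\<^sup>+u. indicator B ((1 - t) * X u + t * Y u) * w u \<partial>unit_interval)"
    if [measurable]: "B \<in> sets borel" for B
  proof -
    have "emeasure N B = (\<integral>\<^sup>+s. indicator B s \<partial>N)" using that by (simp add: N_def)
    also have "\<dots> = (\<integral>\<^sup>+u. indicator B ((1 - t) * X u + t * Y u) \<partial>density unit_interval w)"
      unfolding N_def by (subst nn_integral_distr) auto
    also have "\<dots> = (\<integral>\<^sup>+u. w u * indicator B ((1 - t) * X u + t * Y u) \<partial>unit_interval)"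
      by (subst nn_integral_density) auto
    finally show ?thesis by (simp add: mult.commute)
  qed
  have le: "emeasure N B \<le> emeasure lborel B" if "B \<in> sets borel" for B
  proof (rule emeasure_le_lborel_if_intervals[OF _ _ that])
    show "sets N = sets borel" by (simp add: N_def)
    show "emeasure N C \<le> emeasure lborel C" if "open C" "connected C" for C
      using that unfolding w_def[symmetric]
      by (subst N) (auto simp: w_def intro!: quantile_interpolation_interval X Y f k mX mY t)
  qed
  have "N \<le> lborel"
    using le by (subst le_measure) (auto simp: N_def)
  then have "(\<integral>\<^sup>+s. r s \<partial>N) \<le> (\<integral>\<^sup>+s. r s \<partial>lborel)"
    by (intro nn_integral_mono_measure) (auto simp: N_def)
  also have "(\<integral>\<^sup>+s. r s \<partial>N) = (\<integral>\<^sup>+u. w u * r ((1 - t) * X u + t * Y u) \<partial>unit_interval)"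
    unfolding N_def by (subst nn_integral_distr) (auto simp: nn_integral_density)
  finally show ?thesis by (simp add: w_def mult.commute)
qed

lemma density_quantile:
  fixes f :: "real \<Rightarrow> real"
  assumes [measurable]: "f \<in> borel_measurable borel"
    and f: "\<And>x. 0 \<le> f x" "(\<integral>\<^sup>+x. ennreal (f x) \<partial>lborel) = 1"
  obtains X where "X \<in> borel_measurable unit_interval" "mono_on {0<..<1} X"
    "distr unit_interval borel X = density lborel (\<lambda>x. ennreal (f x))"
proof -
  let ?M = "density lborel (\<lambda>x. ennreal (f x))"
  have "prob_space ?M"
    using f by (intro prob_spaceI) (simp add: emeasure_density)
  then interpret cdf_distribution ?M
    by (simp add: cdf_distribution_def real_distribution_def real_distribution_axioms_def)
  show thesis
  proof (rule that[of I])
    show "I \<in> borel_measurable unit_interval"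
      using measurable_CI by (simp cong: measurable_cong_sets add: sets_restrict_space)
    show "mono_on {0<..<1} I" by (rule mono_I)
    show "distr unit_interval borel I = ?M" by (rule distr_I_eq_M)
  qed
qed

text \<open>
  The interpolations for all parameters start from one and the same coupling
  $u \mapsto (X(u), Y(u))$ of the two densities. Hence the pointwise hypothesis can be integrated over
  \<open>u\<close> first and the sum split afterwards, each summand being bounded by \<open>quantile_interpolation\<close>.
\<close>

lemma mixed_prekopa_leindler_real:
  fixes f k :: "real \<Rightarrow> real" and r :: "'i \<Rightarrow> real \<Rightarrow> ennreal"
  assumes fm[measurable]: "f \<in> borel_measurable borel" and km[measurable]: "k \<in> borel_measurable borel"
    and rm[measurable]: "\<And>i. i \<in> J \<Longrightarrow> r i \<in> borel_measurable borel"
    and f: "\<And>x. 0 \<le> f x" "(\<integral>\<^sup>+x. ennreal (f x) \<partial>lborel) = 1"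
    and k: "\<And>x. 0 \<le> k x" "(\<integral>\<^sup>+x. ennreal (k x) \<partial>lborel) = 1"
    and t: "\<And>i. i \<in> J \<Longrightarrow> 0 < t i \<and> t i < 1"
    and hyp: "\<And>x y. 0 < f x \<Longrightarrow> 0 < k y \<Longrightarrow>
      1 \<le> (\<Sum>i\<in>J. r i ((1 - t i) * x + t i * y) * ennreal (f x powr (t i - 1) * k y powr (- t i)))"
  shows "1 \<le> (\<Sum>i\<in>J. \<integral>\<^sup>+s. r i s \<partial>lborel)"
proof -
  obtain X where X[measurable]: "X \<in> borel_measurable unit_interval" "mono_on {0<..<1} X"
    "distr unit_interval borel X = density lborel (\<lambda>x. ennreal (f x))"
    using density_quantile[OF fm f] by blast
  obtain Y where Y[measurable]: "Y \<in> borel_measurable unit_interval" "mono_on {0<..<1} Y"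
    "distr unit_interval borel Y = density lborel (\<lambda>x. ennreal (k x))"
    using density_quantile[OF km k] by blast
  have "AE u in unit_interval. 0 < f (X u)"
  proof -
    have "AE x in distr unit_interval borel X. 0 < f x"
      unfolding X by (subst AE_density) auto
    then show ?thesis by (subst (asm) AE_distr_iff) auto
  qed
  moreover have "AE u in unit_interval. 0 < k (Y u)"
  proof -
    have "AE x in distr unit_interval borel Y. 0 < k x"
      unfolding Y by (subst AE_density) auto
    then show ?thesis by (subst (asm) AE_distr_iff) auto
  qed
  ultimately have AE: "AE u in unit_interval. 1 \<le> (\<Sum>i\<in>J. r i ((1 - t i) * X u + t i * Y u) *
      ennreal (f (X u) powr (t i - 1) * k (Y u) powr (- t i)))"
    by eventually_elim (rule hyp)
  have "1 = (\<integral>\<^sup>+u. 1 \<partial>unit_interval)"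
    by (simp add: emeasure_restrict_space space_restrict_space)
  also have "\<dots> \<le> (\<integral>\<^sup>+u. (\<Sum>i\<in>J. r i ((1 - t i) * X u + t i * Y u) *
      ennreal (f (X u) powr (t i - 1) * k (Y u) powr (- t i))) \<partial>unit_interval)"
    by (rule nn_integral_mono_AE[OF AE])
  also have "\<dots> = (\<Sum>i\<in>J. \<integral>\<^sup>+u. r i ((1 - t i) * X u + t i * Y u) *
      ennreal (f (X u) powr (t i - 1) * k (Y u) powr (- t i)) \<partial>unit_interval)"
    by (intro nn_integral_sum) measurable
  also have "\<dots> \<le> (\<Sum>i\<in>J. \<integral>\<^sup>+s. r i s \<partial>lborel)"
    using t by (intro sum_mono quantile_interpolation X Y f k) auto
  finally show ?thesis .
qed

section \<open>A Prekopa-Leindler inequality with several parameters\<close>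

abbreviation leb :: "'a set \<Rightarrow> ('a \<Rightarrow> real) measure" where
  "leb I \<equiv> Pi\<^sub>M I (\<lambda>_. lborel)"

text \<open>
  The restriction to \<open>I\<close> keeps the combination in the space of extensional functions.
\<close>

definition mix :: "'a set \<Rightarrow> real \<Rightarrow> ('a \<Rightarrow> real) \<Rightarrow> ('a \<Rightarrow> real) \<Rightarrow> 'a \<Rightarrow> real" where
  "mix I t x y = (\<lambda>i\<in>I. (1 - t) * x i + t * y i)"

lemma mix_fun_upd:
  assumes "a \<notin> I"
  shows "mix (insert a I) t (x(a := p)) (y(a := q)) = (mix I t x y)(a := (1 - t) * p + t * q)"
  using assms by (auto simp: mix_def fun_eq_iff)

lemma measurable_slice:
  assumes "f \<in> borel_measurable (leb (insert a I))"
  shows "(\<lambda>x. f (x(a := s))) \<in> borel_measurable (leb I)"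
  by (rule measurable_compose[OF _ assms]) (auto intro!: measurable_fun_upd[where J = I])

lemma measurable_integral_slice:
  fixes f :: "('a \<Rightarrow> real) \<Rightarrow> ennreal"
  assumes "f \<in> borel_measurable (leb (insert a I))" "finite I"
  shows "(\<lambda>s. \<integral>\<^sup>+x. f (x(a := s)) \<partial>leb I) \<in> borel_measurable borel"
proof -
  interpret product_sigma_finite "\<lambda>_::'a. lborel :: real measure" by standard
  interpret sigma_finite_measure "leb I" by (rule sigma_finite[OF assms(2)])
  have "(\<lambda>p. f ((snd p)(a := fst p))) \<in> borel_measurable (borel \<Otimes>\<^sub>M leb I)"
    by (rule measurable_compose[OF _ assms(1)]) (auto intro!: measurable_fun_upd[where J = I])
  then show ?thesis
    by (intro borel_measurable_nn_integral) (auto simp: case_prod_beta')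
qed

text \<open>
  For a single index \<open>i\<close> the last hypothesis says $r(z) \ge f(x)^{1-t} k(y)^t$ at the intermediate point
  $z$, and this is the Prekopa-Leindler inequality for densities. With several indices only the sum
  of the normalized values has to be bounded below, so different parameters may do the work for
  different pairs.
  
  The hypothesis is inherited by fibres: dividing the slices of \<open>f\<close> and \<open>k\<close> by their integrals
  multiplies \<open>r i\<close> by exactly the powers of the marginals that occur in the one-dimensional
  hypothesis. So the inductive hypothesis applied to the fibres is the hypothesis of
  \<open>mixed_prekopa_leindler_real\<close> for the marginals.
\<close>

lemma mixed_prekopa_leindler:
  fixes f k :: "('a \<Rightarrow> real) \<Rightarrow> real" and r :: "'i \<Rightarrow> ('a \<Rightarrow> real) \<Rightarrow> ennreal"
  assumes "finite I"
    and "f \<in> borel_measurable (leb I)" "k \<in> borel_measurable (leb I)"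
    and "\<And>i. i \<in> J \<Longrightarrow> r i \<in> borel_measurable (leb I)"
    and "\<And>x. 0 \<le> f x" "(\<integral>\<^sup>+x. ennreal (f x) \<partial>leb I) = 1"
    and "\<And>x. 0 \<le> k x" "(\<integral>\<^sup>+x. ennreal (k x) \<partial>leb I) = 1"
    and t: "\<And>i. i \<in> J \<Longrightarrow> 0 < t i \<and> t i < 1"
    and "\<And>x y. x \<in> space (leb I) \<Longrightarrow> y \<in> space (leb I) \<Longrightarrow> 0 < f x \<Longrightarrow> 0 < k y \<Longrightarrow>
      1 \<le> (\<Sum>i\<in>J. r i (mix I (t i) x y) * ennreal (f x powr (t i - 1) * k y powr (- t i)))"
  shows "1 \<le> (\<Sum>i\<in>J. \<integral>\<^sup>+x. r i x \<partial>leb I)"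
  using assms(1-8,10)
proof (induction I arbitrary: f k r rule: finite_induct)
  case empty
  let ?z = "\<lambda>_::'a. undefined :: real"
  have [simp]: "mix {} s ?z ?z = ?z" for s by (simp add: mix_def fun_eq_iff)
  have "ennreal (f ?z) = 1" "ennreal (k ?z) = 1"
    using empty.prems(5,7) by (simp_all add: PiM_empty nn_integral_count_space_finite)
  then have "f ?z = 1" "k ?z = 1" by simp_all
  then show ?case
    using empty.prems(8)[of ?z ?z] by (simp add: PiM_empty nn_integral_count_space_finite)
next
  case (insert a I)
  note fm = insert.prems(1) and km = insert.prems(2) and rm = insert.prems(3)
  interpret product_sigma_finite "\<lambda>_::'a. lborel :: real measure" by standard
  have marginal: "(\<lambda>s. enn2real (\<integral>\<^sup>+x. ennreal (g (x(a := s))) \<partial>leb I)) \<in> borel_measurable borel"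
      "(\<integral>\<^sup>+s. ennreal (enn2real (\<integral>\<^sup>+x. ennreal (g (x(a := s))) \<partial>leb I)) \<partial>lborel) = 1"
    if gm: "g \<in> borel_measurable (leb (insert a I))" and g: "(\<integral>\<^sup>+x. ennreal (g x) \<partial>leb (insert a I)) = 1"
    for g :: "('a \<Rightarrow> real) \<Rightarrow> real"
  proof -
    have gm': "(\<lambda>x. ennreal (g x)) \<in> borel_measurable (leb (insert a I))" using gm by measurable
    have m: "(\<lambda>s. \<integral>\<^sup>+x. ennreal (g (x(a := s))) \<partial>leb I) \<in> borel_measurable borel"
      by (rule measurable_integral_slice[OF gm' insert.hyps(1)])
    then show "(\<lambda>s. enn2real (\<integral>\<^sup>+x. ennreal (g (x(a := s))) \<partial>leb I)) \<in> borel_measurable borel" by measurable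
    have i: "(\<integral>\<^sup>+s. (\<integral>\<^sup>+x. ennreal (g (x(a := s))) \<partial>leb I) \<partial>lborel) = 1"
      using g product_nn_integral_insert_rev[OF insert.hyps gm'] by simp
    have "AE s in lborel. (\<integral>\<^sup>+x. ennreal (g (x(a := s))) \<partial>leb I) \<noteq> \<infinity>"
      using m i by (intro nn_integral_PInf_AE) auto
    then have "AE s in lborel. ennreal (enn2real (\<integral>\<^sup>+x. ennreal (g (x(a := s))) \<partial>leb I)) = (\<integral>\<^sup>+x. ennreal (g (x(a := s))) \<partial>leb I)"
      by eventually_elim (simp add: top.not_eq_extremum)
    then show "(\<integral>\<^sup>+s. ennreal (enn2real (\<integral>\<^sup>+x. ennreal (g (x(a := s))) \<partial>leb I)) \<partial>lborel) = 1"
      using i by (simp cong: nn_integral_cong_AE)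
  qed
  have normalize: "(\<integral>\<^sup>+x. ennreal (g (x(a := s)) / G) \<partial>leb I) = 1"
    if gm: "g \<in> borel_measurable (leb (insert a I))" and g: "\<And>x. 0 \<le> g x"
      and G: "G = enn2real (\<integral>\<^sup>+x. ennreal (g (x(a := s))) \<partial>leb I)" "0 < G"
    for g :: "('a \<Rightarrow> real) \<Rightarrow> real" and s G
  proof -
    have [measurable]: "(\<lambda>x. g (x(a := s))) \<in> borel_measurable (leb I)" by (rule measurable_slice[OF gm])
    have "(\<integral>\<^sup>+x. ennreal (g (x(a := s))) \<partial>leb I) = ennreal G"
      using G by (metis enn2real_eq_0_iff ennreal_enn2real less_irrefl top.not_eq_extremum infinity_ennreal_def)
    moreover have "(\<integral>\<^sup>+x. ennreal (g (x(a := s)) / G) \<partial>leb I)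
        = (\<integral>\<^sup>+x. ennreal (1 / G) * ennreal (g (x(a := s))) \<partial>leb I)"
      using g G by (intro nn_integral_cong) (simp add: ennreal_mult[symmetric])
    ultimately show ?thesis
      using G(2) by (simp add: nn_integral_cmult ennreal_mult[symmetric])
  qed
  \<comment> \<open>Slices of infinite integral form a null set; there the marginals take the value 0.\<close>
  define F where "F = (\<lambda>s. enn2real (\<integral>\<^sup>+x. ennreal (f (x(a := s))) \<partial>leb I))"
  define K where "K = (\<lambda>s. enn2real (\<integral>\<^sup>+x. ennreal (k (x(a := s))) \<partial>leb I))"
  have "1 \<le> (\<Sum>i\<in>J. \<integral>\<^sup>+s. (\<integral>\<^sup>+x. r i (x(a := s)) \<partial>leb I) \<partial>lborel)"
  proof (rule mixed_prekopa_leindler_real[where f = F and k = K and t = t])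
    show "F \<in> borel_measurable borel" "K \<in> borel_measurable borel"
      "(\<integral>\<^sup>+s. ennreal (F s) \<partial>lborel) = 1" "(\<integral>\<^sup>+s. ennreal (K s) \<partial>lborel) = 1"
      using marginal[OF fm insert.prems(5)] marginal[OF km insert.prems(7)] by (simp_all only: F_def K_def)
    show "(\<lambda>s. \<integral>\<^sup>+x. r i (x(a := s)) \<partial>leb I) \<in> borel_measurable borel" if "i \<in> J" for i
      by (rule measurable_integral_slice[OF rm[OF that] insert.hyps(1)])
    fix p q assume pq: "0 < F p" "0 < K q"
    define c where "c i = ennreal (F p powr (t i - 1) * K q powr (- t i))" for i
    let ?r = "\<lambda>i x. r i (x(a := (1 - t i) * p + t i * q)) * c i"
    have "1 \<le> (\<Sum>i\<in>J. \<integral>\<^sup>+x. ?r i x \<partial>leb I)"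
    proof (rule insert.IH[where f = "\<lambda>x. f (x(a := p)) / F p" and k = "\<lambda>x. k (x(a := q)) / K q"])
      show "(\<lambda>x. f (x(a := p)) / F p) \<in> borel_measurable (leb I)"
        "(\<lambda>x. k (x(a := q)) / K q) \<in> borel_measurable (leb I)"
        using measurable_slice[OF fm, of p] measurable_slice[OF km, of q] by measurable
      show "(\<integral>\<^sup>+x. ennreal (f (x(a := p)) / F p) \<partial>leb I) = 1"
        using pq by (intro normalize[OF fm insert.prems(4)]) (simp_all only: F_def)
      show "(\<integral>\<^sup>+x. ennreal (k (x(a := q)) / K q) \<partial>leb I) = 1"
        using pq by (intro normalize[OF km insert.prems(6)]) (simp_all only: K_def)
      show "?r i \<in> borel_measurable (leb I)" if "i \<in> J" for i
        using measurable_slice[OF rm[OF that]] by measurable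
      show "0 \<le> f (x(a := p)) / F p" "0 \<le> k (x(a := q)) / K q" for x
        using insert.prems(4,6) pq by simp_all
      fix x y :: "'a \<Rightarrow> real"
      assume xy: "x \<in> space (leb I)" "y \<in> space (leb I)" "0 < f (x(a := p)) / F p" "0 < k (y(a := q)) / K q"
      have pos: "0 < f (x(a := p))" "0 < k (y(a := q))" using xy pq by (simp_all add: zero_less_divide_iff)
      have sp: "x(a := p) \<in> space (leb (insert a I))" "y(a := q) \<in> space (leb (insert a I))"
        using xy(1,2) insert.hyps(2) by (auto simp: space_PiM PiE_def extensional_def)
      have "1 \<le> (\<Sum>i\<in>J. r i (mix (insert a I) (t i) (x(a := p)) (y(a := q))) *
          ennreal (f (x(a := p)) powr (t i - 1) * k (y(a := q)) powr (- t i)))"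
        by (rule insert.prems(8)[OF sp pos])
      also have "\<dots> = (\<Sum>i\<in>J. ?r i (mix I (t i) x y) *
          ennreal ((f (x(a := p)) / F p) powr (t i - 1) * (k (y(a := q)) / K q) powr (- t i)))"
      proof (intro sum.cong refl)
        fix i
        have "c i * ennreal ((f (x(a := p)) / F p) powr (t i - 1) * (k (y(a := q)) / K q) powr (- t i))
            = ennreal (f (x(a := p)) powr (t i - 1) * k (y(a := q)) powr (- t i))"
          using pos pq by (simp add: c_def ennreal_mult[symmetric] powr_divide)
        then show "r i (mix (insert a I) (t i) (x(a := p)) (y(a := q))) *
            ennreal (f (x(a := p)) powr (t i - 1) * k (y(a := q)) powr (- t i))
          = ?r i (mix I (t i) x y) *
            ennreal ((f (x(a := p)) / F p) powr (t i - 1) * (k (y(a := q)) / K q) powr (- t i))"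
          by (simp add: mix_fun_upd[OF insert.hyps(2)] mult.assoc)
      qed
      finally show "1 \<le> (\<Sum>i\<in>J. ?r i (mix I (t i) x y) *
          ennreal ((f (x(a := p)) / F p) powr (t i - 1) * (k (y(a := q)) / K q) powr (- t i)))" .
    qed
    also have "\<dots> = (\<Sum>i\<in>J. (\<integral>\<^sup>+x. r i (x(a := (1 - t i) * p + t i * q)) \<partial>leb I) * c i)"
      by (intro sum.cong refl nn_integral_multc measurable_slice rm)
    finally show "1 \<le> (\<Sum>i\<in>J. (\<integral>\<^sup>+x. r i (x(a := (1 - t i) * p + t i * q)) \<partial>leb I) *
        ennreal (F p powr (t i - 1) * K q powr (- t i)))" by (simp add: c_def)
  qed (use t in \<open>auto simp: F_def K_def\<close>)
  also have "\<dots> = (\<Sum>i\<in>J. \<integral>\<^sup>+x. r i x \<partial>leb (insert a I))"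
    by (intro sum.cong refl product_nn_integral_insert_rev[symmetric] insert.hyps rm)
  finally show ?case .
qed

section \<open>Dilation inequality for quadratic polynomials\<close>

definition quad :: "nat \<Rightarrow> (nat \<Rightarrow> nat \<Rightarrow> real) \<Rightarrow> (nat \<Rightarrow> real) \<Rightarrow> real" where
  "quad n A x = (\<Sum>i<n. \<Sum>j<n. A i j * x i * x j)"

lemma measurable_quad [measurable]: "quad n A \<in> borel_measurable (leb {..<n})"
proof -
  have [measurable]: "(\<lambda>x. x i) \<in> borel_measurable (leb {..<n})" if "i \<in> {..<n}" for i
    using measurable_component_singleton[OF that, of "\<lambda>_. lborel :: real measure"] by simp
  show ?thesis unfolding quad_def[abs_def] by measurable
qed

lemma quad_mix: "\<exists>b c. \<forall>t. quad n A (mix {..<n} t x y) = quad n A x + b * t + c * t\<^sup>2"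
proof (intro exI allI)
  fix t
  let ?b = "\<Sum>i<n. \<Sum>j<n. A i j * (x i * (y j - x j) + (y i - x i) * x j)"
  let ?c = "\<Sum>i<n. \<Sum>j<n. A i j * ((y i - x i) * (y j - x j))"
  have "quad n A (mix {..<n} t x y) = (\<Sum>i<n. \<Sum>j<n. A i j * x i * x j
      + A i j * (x i * (y j - x j) + (y i - x i) * x j) * t
      + A i j * ((y i - x i) * (y j - x j)) * t\<^sup>2)"
    unfolding quad_def mix_def
    by (intro sum.cong refl) (simp add: algebra_simps power2_eq_square)
  then show "quad n A (mix {..<n} t x y) = quad n A x + ?b * t + ?c * t\<^sup>2"
    by (simp add: quad_def sum.distrib sum_distrib_right)
qed

text \<open>
  Lagrange interpolation at the nodes $u, v, w$, evaluated at $0$.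
\<close>

lemma quadratic_extrapolation:
  fixes p :: "real \<Rightarrow> real"
  assumes p: "\<And>t. p t = a + b * t + c * t\<^sup>2"
    and d: "0 < d" "d \<le> \<bar>u - v\<bar>" "d \<le> \<bar>u - w\<bar>" "d \<le> \<bar>v - w\<bar>"
    and uvw: "u \<in> {0..1}" "v \<in> {0..1}" "w \<in> {0..1}"
    and le: "\<bar>p u\<bar> \<le> l" "\<bar>p v\<bar> \<le> l" "\<bar>p w\<bar> \<le> l"
  shows "\<bar>p 0\<bar> \<le> 3 / d\<^sup>2 * l"
proof -
  have l0: "0 \<le> l" using le(1) by linarith
  have ne: "u \<noteq> v" "u \<noteq> w" "v \<noteq> w" using d by auto
  have single: "\<bar>p x * (y * z / ((x - y) * (x - z)))\<bar> \<le> l / d\<^sup>2"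
    if "\<bar>p x\<bar> \<le> l" "y \<in> {0..1}" "z \<in> {0..1}" "d \<le> \<bar>x - y\<bar>" "d \<le> \<bar>x - z\<bar>" for x y z
  proof -
    have "d * d \<le> \<bar>x - y\<bar> * \<bar>x - z\<bar>" using that d by (intro mult_mono) auto
    moreover have "\<bar>y * z\<bar> \<le> 1" using that by (auto simp: abs_mult intro!: mult_le_one)
    ultimately have "\<bar>y * z\<bar> / (\<bar>x - y\<bar> * \<bar>x - z\<bar>) \<le> 1 / (d * d)"
      using d(1) by (intro frac_le) auto
    then have "\<bar>p x\<bar> * (\<bar>y * z\<bar> / (\<bar>x - y\<bar> * \<bar>x - z\<bar>)) \<le> l * (1 / (d * d))"
      using that l0 by (intro mult_mono) auto
    then show ?thesis by (simp add: abs_mult power2_eq_square)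
  qed
  have "p 0 = p u * (v * w / ((u - v) * (u - w))) + p v * (u * w / ((v - u) * (v - w)))
      + p w * (u * v / ((w - u) * (w - v)))"
  proof -
    have nz: "u - v \<noteq> 0" "u - w \<noteq> 0" "v - w \<noteq> 0" "v - u \<noteq> 0" "w - u \<noteq> 0" "w - v \<noteq> 0" using ne by auto
    have "p 0 * ((u - v) * (u - w) * (v - w)) = p u * (v * w) * (v - w) - p v * (u * w) * (u - w) + p w * (u * v) * (u - v)"
      unfolding p by (simp add: algebra_simps power2_eq_square)
    then have "p 0 = (p u * (v * w) * (v - w) - p v * (u * w) * (u - w) + p w * (u * v) * (u - v)) / ((u - v) * (u - w) * (v - w))"
      using nz by (simp add: eq_divide_eq)
    also have "\<dots> = p u * (v * w / ((u - v) * (u - w))) + p v * (u * w / ((v - u) * (v - w)))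
      + p w * (u * v / ((w - u) * (w - v)))"
    proof -
      have "(v - u) * (v - w) = - ((u - v) * (v - w))" "(w - u) * (w - v) = (u - w) * (v - w)"
        by (simp_all add: algebra_simps)
      then show ?thesis using nz by (simp only:) (simp add: add_divide_distrib diff_divide_distrib)
    qed
    finally show ?thesis .
  qed
  also have "\<bar>\<dots>\<bar> \<le> \<bar>p u * (v * w / ((u - v) * (u - w)))\<bar> + \<bar>p v * (u * w / ((v - u) * (v - w)))\<bar>
      + \<bar>p w * (u * v / ((w - u) * (w - v)))\<bar>" by linarith
  also have "\<dots> \<le> l / d\<^sup>2 + l / d\<^sup>2 + l / d\<^sup>2"
    using d uvw le by (intro add_mono single) (auto simp: abs_minus_commute)
  finally show ?thesis by simp
qed

text \<open>
  The sixteen nodes lie close to $1$, so that the exponents $1 - t$ in the Prekopa-Leindler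
  inequality are at most $1/10$, yet they are far enough apart for an extrapolation from any three
  of them to $0$.
\<close>

lemma few_small_values:
  fixes p :: "real \<Rightarrow> real"
  assumes p: "\<And>t. p t = a + b * t + c * t\<^sup>2" and l: "10 ^ 5 * l < \<bar>p 0\<bar>" and l0: "0 \<le> l"
  shows "card {i\<in>{1..16::nat}. \<bar>p (1 - real i / 160)\<bar> \<le> l} \<le> 2"
proof (rule ccontr)
  let ?S = "{i\<in>{1..16::nat}. \<bar>p (1 - real i / 160)\<bar> \<le> l}"
  assume "\<not> card ?S \<le> 2"
  then have "3 \<le> card ?S" by simp
  then obtain T where "T \<subseteq> ?S" "card T = 3" by (rule obtain_subset_with_card_n)
  then obtain i j m where ijm: "i \<in> ?S" "j \<in> ?S" "m \<in> ?S" "i \<noteq> j" "i \<noteq> m" "j \<noteq> m"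
    by (auto simp: card_3_iff)
  have d: "1 / 160 \<le> \<bar>(1 - real i / 160) - (1 - real j / 160)\<bar>" if "i \<noteq> j" for i j :: nat
  proof -
    have "1 \<le> \<bar>real i - real j\<bar>" using that by linarith
    then show ?thesis by (simp add: field_simps abs_if split: if_splits)
  qed
  have "\<bar>p 0\<bar> \<le> 3 / (1 / 160)\<^sup>2 * l"
    using ijm by (intro quadratic_extrapolation[OF p _ d[OF ijm(4)] d[OF ijm(5)] d[OF ijm(6)]]) auto
  also have "\<dots> \<le> 10 ^ 5 * l" using l0 by (intro mult_right_mono) (auto simp: power2_eq_square)
  finally show False using l by simp
qed

text \<open>
  Real values, in place of $e^{-H}$ with an extended real $H$, allow log-concavity to be stated with
  real powers, in the form in which \<open>mixed_prekopa_leindler\<close> uses it.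
\<close>

locale log_concave_measure = prob_space M for M :: "(nat \<Rightarrow> real) measure" +
  fixes n :: nat and \<rho> :: "(nat \<Rightarrow> real) \<Rightarrow> real"
  assumes measurable_density: "\<rho> \<in> borel_measurable (leb {..<n})"
    and density_nonneg: "0 \<le> \<rho> x"
    and M_eq: "M = density (leb {..<n}) (\<lambda>x. ennreal (\<rho> x))"
    and density_mix: "\<lbrakk>x \<in> Rn n; y \<in> Rn n; 0 < \<rho> x; 0 < \<rho> y; 0 < t; t < 1\<rbrakk> \<Longrightarrow>
      \<rho> x powr (1 - t) * \<rho> y powr t \<le> \<rho> (mix {..<n} t x y)"
begin

declare measurable_density [measurable]

lemma sets_M [measurable_cong]: "sets M = sets (leb {..<n})" by (simp add: M_eq)

lemma space_M: "space M = Rn n" by (simp add: M_eq space_PiM Rn_def)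

lemma space_leb: "space (leb {..<n}) = Rn n" by (simp add: space_PiM Rn_def)

lemma measurable_quad' [measurable]: "quad n A \<in> borel_measurable M"
  by measurable

text \<open>
  Take \<open>f\<close> to be the density conditioned on $S = \{|P| > 10^5 l\}$ and \<open>k\<close> the density itself. On the
  segment from a point $x \in S$ to any $y$, the polynomial $P$ is quadratic in the parameter, so at
  least $14$ of the $16$ nodes lie in $G = \{|P| > l\}$. Which nodes these are depends on $x$ and $y$;
  this is where all parameters have to be treated together. The resulting inequality is
  $1 \le \frac{16}{14} \mu(G) \mu(S)^{-1/10}$.
\<close>

lemma quad_dilation:
  assumes l: "0 \<le> l"
  shows "prob {x\<in>space M. 10 ^ 5 * l < \<bar>quad n A x - m\<bar>} powr (1 / 10)
    \<le> 8 / 7 * prob {x\<in>space M. l < \<bar>quad n A x - m\<bar>}"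
proof -
  define P where "P x = quad n A x - m" for x
  have [measurable]: "P \<in> borel_measurable (leb {..<n})" unfolding P_def by measurable
  define S where "S = {x\<in>space M. 10 ^ 5 * l < \<bar>P x\<bar>}"
  define G where "G = {x\<in>space M. l < \<bar>P x\<bar>}"
  have SG[measurable]: "S \<in> sets (leb {..<n})" "G \<in> sets (leb {..<n})"
    unfolding S_def G_def space_M space_leb[symmetric] by measurable
  define \<alpha> where "\<alpha> = prob S"
  have int: "(\<integral>\<^sup>+x. ennreal (\<rho> x * indicator B x) \<partial>leb {..<n}) = ennreal (prob B)"
    if [measurable]: "B \<in> sets (leb {..<n})" for B
  proof -
    have "emeasure M B = (\<integral>\<^sup>+x. ennreal (\<rho> x) * indicator B x \<partial>leb {..<n})"
      unfolding M_eq by (rule emeasure_density) auto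
    also have "\<dots> = (\<integral>\<^sup>+x. ennreal (\<rho> x * indicator B x) \<partial>leb {..<n})"
      by (intro nn_integral_cong) (auto simp: indicator_def)
    finally show ?thesis by (simp add: emeasure_eq_measure)
  qed
  show ?thesis
  proof (cases "\<alpha> = 0")
    case True then show ?thesis by (simp add: \<alpha>_def S_def P_def)
  next
    case False
    then have \<alpha>: "0 < \<alpha>" "\<alpha> \<le> 1" by (auto simp: \<alpha>_def zero_less_measure_iff)
    define t where "t i = 1 - real i / 160" for i :: nat
    define f where "f x = \<rho> x * indicator S x / \<alpha>" for x
    define r where "r i x = ennreal (1 / (14 * \<alpha> powr (real i / 160))) * ennreal (\<rho> x * indicator G x)" for i :: nat and x
    have "1 \<le> (\<Sum>i\<in>{1..16}. \<integral>\<^sup>+x. r i x \<partial>leb {..<n})"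
    proof (rule mixed_prekopa_leindler[where f = f and k = \<rho> and t = t])
      show "f \<in> borel_measurable (leb {..<n})" unfolding f_def by measurable
      show "\<rho> \<in> borel_measurable (leb {..<n})" by measurable
      show "r i \<in> borel_measurable (leb {..<n})" for i unfolding r_def by measurable
      show "0 \<le> f x" "0 \<le> \<rho> x" for x using \<alpha> density_nonneg by (auto simp: f_def)
      have "(\<integral>\<^sup>+x. ennreal (f x) \<partial>leb {..<n}) = (\<integral>\<^sup>+x. ennreal (1 / \<alpha>) * ennreal (\<rho> x * indicator S x) \<partial>leb {..<n})"
        using \<alpha> density_nonneg by (intro nn_integral_cong) (simp add: f_def ennreal_mult[symmetric])
      also have "\<dots> = 1"
        using \<alpha> by (simp add: nn_integral_cmult int ennreal_mult[symmetric] flip: \<alpha>_def)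
      finally show "(\<integral>\<^sup>+x. ennreal (f x) \<partial>leb {..<n}) = 1" .
      have "(\<integral>\<^sup>+x. ennreal (\<rho> x) \<partial>leb {..<n}) = emeasure M (space M)"
        unfolding M_eq by (simp add: emeasure_density cong: nn_integral_cong_simp)
      then show "(\<integral>\<^sup>+x. ennreal (\<rho> x) \<partial>leb {..<n}) = 1" by (simp add: emeasure_space_1)
      show "0 < t i \<and> t i < 1" if "i \<in> {1..16}" for i using that by (simp add: t_def)
      fix x y assume x: "x \<in> space (leb {..<n})" and y: "y \<in> space (leb {..<n})"
        and "0 < f x" and py: "0 < \<rho> y"
      then have px: "0 < \<rho> x" and xS: "x \<in> S"
        using density_nonneg[of x] \<alpha> by (auto simp: f_def zero_less_divide_iff zero_less_mult_iff indicator_def split: if_splits)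
      let ?z = "\<lambda>i. mix {..<n} (t i) x y"
      let ?g = "{i\<in>{1..16::nat}. ?z i \<in> G}"
      obtain b c where bc: "\<And>s. quad n A (mix {..<n} s x y) = quad n A x + b * s + c * s\<^sup>2"
        using quad_mix by meson
      have z: "?z i \<in> space M" for i by (auto simp: space_M Rn_def mix_def)
      have "card {i\<in>{1..16::nat}. \<bar>P (?z i)\<bar> \<le> l} \<le> 2"
        unfolding t_def
        by (rule few_small_values[of _ "quad n A x - m" b c])
           (use xS l bc in \<open>auto simp: S_def P_def\<close>)
      moreover have "{i\<in>{1..16::nat}. \<bar>P (?z i)\<bar> \<le> l} = {1..16} - ?g"
        using z by (auto simp: G_def)
      ultimately have "card ({1..16::nat} - ?g) \<le> 2" by simp
      moreover have "card ({1..16::nat} - ?g) = 16 - card ?g"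
        by (subst card_Diff_subset) auto
      ultimately have 14: "14 \<le> card ?g" by linarith
      have summand: "ennreal (1 / 14) \<le> r i (?z i) * ennreal (f x powr (t i - 1) * \<rho> y powr (- t i))"
        if i: "i \<in> ?g" for i
      proof -
        have ti: "0 < t i" "t i < 1" "real i / 160 = 1 - t i" using i by (auto simp: t_def)
        have "\<rho> x powr (1 - t i) * \<rho> y powr (t i) \<le> \<rho> (?z i)"
          using x y px py ti by (intro density_mix) (auto simp: space_leb)
        then have "\<rho> x powr (1 - t i) * \<rho> y powr (t i) * (\<rho> x powr (t i - 1) * \<rho> y powr (- t i))
            \<le> \<rho> (?z i) * (\<rho> x powr (t i - 1) * \<rho> y powr (- t i))"
          by (intro mult_right_mono) auto
        also have "\<rho> x powr (1 - t i) * \<rho> y powr (t i) * (\<rho> x powr (t i - 1) * \<rho> y powr (- t i))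
            = (\<rho> x powr (1 - t i) * \<rho> x powr (t i - 1)) * (\<rho> y powr (t i) * \<rho> y powr (- t i))"
          by (simp only: ac_simps)
        also have "\<dots> = 1" using px py by (simp add: powr_add[symmetric])
        finally have 1: "1 \<le> \<rho> (?z i) * (\<rho> x powr (t i - 1) * \<rho> y powr (- t i))" .
        have fx: "f x powr (t i - 1) = \<rho> x powr (t i - 1) * \<alpha> powr (1 - t i)"
          using px \<alpha> xS powr_minus_divide[of \<alpha> "1 - t i"] by (simp add: f_def powr_divide)
        have "r i (?z i) * ennreal (f x powr (t i - 1) * \<rho> y powr (- t i))
          = ennreal (1 / (14 * \<alpha> powr (1 - t i)) * \<rho> (?z i) * (f x powr (t i - 1) * \<rho> y powr (- t i)))"
          using i density_nonneg by (simp add: r_def ti(3) ennreal_mult[symmetric])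
        also have "\<dots> = ennreal (1 / 14 * (\<rho> (?z i) * (\<rho> x powr (t i - 1) * \<rho> y powr (- t i))))"
          using \<alpha> by (simp add: fx)
        finally show ?thesis using 1 by (simp add: ennreal_leI)
      qed
      have "1 \<le> (\<Sum>i\<in>?g. ennreal (1 / 14))"
      proof -
        have "ennreal 1 \<le> ennreal (real (card ?g) * (1 / 14))" using 14 by (intro ennreal_leI) auto
        also have "\<dots> = (\<Sum>i\<in>?g. ennreal (1 / 14))" by (subst sum_ennreal) simp_all
        finally show ?thesis by simp
      qed
      also have "\<dots> \<le> (\<Sum>i\<in>?g. r i (?z i) * ennreal (f x powr (t i - 1) * \<rho> y powr (- t i)))"
        by (intro sum_mono summand)
      also have "\<dots> \<le> (\<Sum>i\<in>{1..16}. r i (?z i) * ennreal (f x powr (t i - 1) * \<rho> y powr (- t i)))"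
        by (intro sum_mono2) auto
      finally show "1 \<le> (\<Sum>i\<in>{1..16}. r i (?z i) * ennreal (f x powr (t i - 1) * \<rho> y powr (- t i)))" .
    qed simp
    also have "\<dots> = (\<Sum>i\<in>{1..16}. ennreal (1 / (14 * \<alpha> powr (real i / 160)) * prob G))"
      unfolding r_def by (intro sum.cong refl) (subst nn_integral_cmult, simp_all add: int ennreal_mult[symmetric])
    also have "\<dots> \<le> (\<Sum>i\<in>{1..16::nat}. ennreal (1 / (14 * \<alpha> powr (1 / 10)) * prob G))"
    proof (intro sum_mono ennreal_leI mult_right_mono)
      fix i :: nat assume "i \<in> {1..16}"
      then have "\<alpha> powr (1 / 10) \<le> \<alpha> powr (real i / 160)"
        using \<alpha> by (intro powr_mono') auto
      then show "1 / (14 * \<alpha> powr (real i / 160)) \<le> 1 / (14 * \<alpha> powr (1 / 10))"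
        using \<alpha> by (simp add: frac_le)
    qed simp
    also have "\<dots> = ennreal (16 / (14 * \<alpha> powr (1 / 10)) * prob G)"
      by (subst sum_ennreal) (auto simp: algebra_simps)
    finally have "1 \<le> 16 / (14 * \<alpha> powr (1 / 10)) * prob G" by simp
    then have "\<alpha> powr (1 / 10) \<le> 8 / 7 * prob G" using \<alpha> by (simp add: field_simps)
    then show ?thesis by (simp add: \<alpha>_def S_def G_def P_def)
  qed
qed

end

section \<open>Tails and lower deviations of quadratic forms\<close>

lemma (in prob_space) quantile_exists:
  fixes X :: "'a \<Rightarrow> real"
  assumes X[measurable]: "X \<in> borel_measurable M" and p: "0 < p" "p < 1"
  obtains q where "p \<le> prob {x\<in>space M. X x \<le> q}" "\<And>s. s < q \<Longrightarrow> prob {x\<in>space M. X x \<le> s} < p"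
proof -
  interpret D: prob_space "distr M borel X" by (rule prob_space_distr[OF X])
  interpret cdf_distribution "distr M borel X"
    by (simp add: cdf_distribution_def real_distribution_def real_distribution_axioms_def D.prob_space_axioms)
  have C: "cdf (distr M borel X) s = prob {x\<in>space M. X x \<le> s}" for s
    unfolding cdf_def by (subst measure_distr) (auto intro!: arg_cong[where f = prob])
  have "p \<le> prob {x\<in>space M. X x \<le> s} \<longleftrightarrow> I p \<le> s" for s
    using pseudoinverse[of p s] p by (simp add: C)
  then show thesis by (intro that[of "I p"]) (auto simp: not_le[symmetric])
qed

text \<open>
  The bound for $\mathrm{E} P^2 / L^2$ obtained by cutting the values of $|P|$ at the levels
  $10^{5j} L$, where \<open>quad_tail\<close> bounds the probability of exceeding the level.
\<close>

definition second_moment_const :: real where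
  "second_moment_const = 1 + (\<Sum>j. (10 ^ 5) ^ (2 * Suc j) * (2 / 7) ^ (9 ^ j))"

lemma summable_second_moment_const: "summable (\<lambda>j. (10 ^ 5) ^ (2 * Suc j) * (2 / 7 :: real) ^ (9 ^ j))"
proof (rule summable_ratio_test[where c = "1 / 2" and N = 1])
  fix j :: nat assume j: "1 \<le> j"
  have "(9::nat) ^ 1 \<le> 9 ^ j" using j by (intro power_increasing) auto
  then have e: "9 ^ j + 40 \<le> (9::nat) ^ Suc j" by simp
  have "(2 / 7 :: real) ^ (9 ^ Suc j) \<le> (2 / 7) ^ (9 ^ j + 40)"
    using e by (intro power_decreasing) auto
  also have "\<dots> = (2 / 7) ^ (9 ^ j) * (2 / 7) ^ 40" by (rule power_add)
  finally have "(10 ^ 5) ^ (2 * Suc (Suc j)) * (2 / 7 :: real) ^ (9 ^ Suc j)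
      \<le> (10 ^ 5) ^ (2 * Suc (Suc j)) * ((2 / 7) ^ (9 ^ j) * (2 / 7) ^ 40)"
    by (intro mult_left_mono) auto
  also have "\<dots> = ((10 ^ 5)\<^sup>2 * (2 / 7) ^ 40) * ((10 ^ 5) ^ (2 * Suc j) * (2 / 7) ^ (9 ^ j))"
  proof -
    have "(10 ^ 5 :: real) ^ (2 * Suc (Suc j)) = (10 ^ 5)\<^sup>2 * (10 ^ 5) ^ (2 * Suc j)"
      by (simp only: power_add[symmetric]) simp
    then show ?thesis by (simp only: ac_simps)
  qed
  also have "\<dots> \<le> (1 / 2) * ((10 ^ 5) ^ (2 * Suc j) * (2 / 7) ^ (9 ^ j))"
    by (intro mult_right_mono) (auto simp: field_simps)
  finally show "norm ((10 ^ 5) ^ (2 * Suc (Suc j)) * (2 / 7 :: real) ^ (9 ^ Suc j))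
      \<le> (1 / 2) * norm ((10 ^ 5) ^ (2 * Suc j) * (2 / 7 :: real) ^ (9 ^ j))"
    by (simp only: norm_mult norm_power norm_divide norm_numeral)
qed simp

lemma second_moment_const_pos: "0 < second_moment_const"
  unfolding second_moment_const_def
  by (intro add_pos_nonneg suminf_nonneg summable_second_moment_const) auto

context log_concave_measure
begin

text \<open>
  Let $a_j$ be the probability on the left. By \<open>quad_dilation\<close>, $a_{j+1} \le (8 a_j / 7)^{10}$; one of
  the ten factors absorbs the constant $8/7$ and the other nine produce the exponent $9^j$.
\<close>

lemma quad_tail:
  assumes L: "0 \<le> L" and q: "prob {x\<in>space M. L < \<bar>quad n A x - m\<bar>} \<le> 1 / 4"
  shows "prob {x\<in>space M. (10 ^ 5) ^ j * L < \<bar>quad n A x - m\<bar>} \<le> (2 / 7) ^ (9 ^ j)"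
proof -
  define a where "a j = prob {x\<in>space M. (10 ^ 5) ^ j * L < \<bar>quad n A x - m\<bar>}" for j :: nat
  have step: "a (Suc j) \<le> (8 / 7 * a j) ^ 10" for j
  proof -
    have "a (Suc j) powr (1 / 10) \<le> 8 / 7 * a j"
      using quad_dilation[of "(10 ^ 5) ^ j * L" A m] L unfolding a_def power_Suc mult.assoc by auto
    then have "(a (Suc j) powr (1 / 10)) ^ 10 \<le> (8 / 7 * a j) ^ 10"
      by (intro power_mono) auto
    moreover have "(a (Suc j) powr (1 / 10)) ^ 10 = a (Suc j)"
      by (cases "a (Suc j) = 0") (auto simp: a_def powr_realpow[symmetric] powr_powr zero_less_measure_iff)
    ultimately show ?thesis by simp
  qed
  have "8 / 7 * a j \<le> (2 / 7) ^ (9 ^ j)"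
  proof (induction j)
    case 0 then show ?case using q by (simp add: a_def)
  next
    case (Suc j)
    let ?c = "8 / 7 * a j"
    have c0: "0 \<le> ?c" by (simp add: a_def)
    have "(2 / 7 :: real) ^ (9 ^ j) \<le> (2 / 7) ^ 1" by (intro power_decreasing) auto
    then have c1: "?c \<le> 2 / 7" using Suc by simp
    have "8 / 7 * a (Suc j) \<le> 8 / 7 * ?c ^ 10" using step[of j] by simp
    also have "\<dots> = (8 / 7 * ?c) * ?c ^ 9" by (simp add: power_Suc[of _ 9, simplified] del: power_mult_distrib)
    also have "\<dots> \<le> 1 * ?c ^ 9" using c0 c1 by (intro mult_right_mono) auto
    also have "\<dots> \<le> ((2 / 7) ^ (9 ^ j)) ^ 9" using Suc c0 by (simp add: power_mono del: power_mult_distrib)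
    also have "\<dots> = (2 / 7) ^ (9 ^ Suc j)" by (simp add: power_mult[symmetric] mult.commute)
    finally show ?case .
  qed
  moreover have "0 \<le> a j" by (simp add: a_def)
  ultimately show ?thesis unfolding a_def[symmetric] by simp
qed

lemma quad_second_moment:
  assumes L: "0 < L" and q: "prob {x\<in>space M. L < \<bar>quad n A x - m\<bar>} \<le> 1 / 4"
  shows "(\<integral>\<^sup>+x. ennreal ((quad n A x - m)\<^sup>2) \<partial>M) \<le> ennreal (second_moment_const * L\<^sup>2)"
proof -
  define P where "P x = quad n A x - m" for x
  have [measurable]: "P \<in> borel_measurable M" unfolding P_def by measurable
  define S where "S j = {x\<in>space M. (10 ^ 5) ^ j * L < \<bar>P x\<bar>}" for j :: nat
  have [measurable]: "S j \<in> sets M" for j unfolding S_def by measurable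
  define w where "w j = ((10 ^ 5) ^ Suc j * L)\<^sup>2" for j :: nat
  have le_suminf: "g i \<le> suminf g" for g :: "nat \<Rightarrow> ennreal" and i
    using sum_le_suminf[of g "{i}"] by simp
  have pointwise: "ennreal ((P x)\<^sup>2) \<le> ennreal (L\<^sup>2) + (\<Sum>j. ennreal (w j) * indicator (S j) x)"
    if x: "x \<in> space M" for x
  proof (cases "\<bar>P x\<bar> \<le> L")
    case True
    then have "(P x)\<^sup>2 \<le> L\<^sup>2" using L by (simp add: abs_le_square_iff[symmetric])
    then show ?thesis by (intro add_increasing2) (auto intro: ennreal_leI)
  next
    case False
    let ?N = "\<lambda>N. \<bar>P x\<bar> \<le> (10 ^ 5) ^ N * L"
    obtain N where "\<bar>P x\<bar> / L < (10 ^ 5 :: real) ^ N" using real_arch_pow[of "10 ^ 5"] by auto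
    then have "?N N" using L by (simp add: field_simps)
    then have N: "?N (Least ?N)" by (rule LeastI)
    moreover have "\<not> ?N 0" using False by simp
    ultimately obtain j where j: "Least ?N = Suc j" by (cases "Least ?N") auto
    then have "\<not> ?N j" by (metis lessI not_less_Least)
    then have xj: "x \<in> S j" using x by (simp add: S_def)
    have "(P x)\<^sup>2 \<le> w j"
      using N L unfolding j w_def by (intro power2_le_iff_abs_le[THEN iffD2]) auto
    then have "ennreal ((P x)\<^sup>2) \<le> ennreal (w j) * indicator (S j) x" using xj by (simp add: ennreal_leI)
    also have "\<dots> \<le> (\<Sum>j. ennreal (w j) * indicator (S j) x)"
      by (rule le_suminf)
    finally show ?thesis by (intro add_increasing) auto
  qed
  have "(\<integral>\<^sup>+x. ennreal ((P x)\<^sup>2) \<partial>M) \<le> (\<integral>\<^sup>+x. (ennreal (L\<^sup>2) + (\<Sum>j. ennreal (w j) * indicator (S j) x)) \<partial>M)"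
    by (rule nn_integral_mono[OF pointwise])
  also have "\<dots> = ennreal (L\<^sup>2) + (\<Sum>j. ennreal (w j) * emeasure M (S j))"
    by (subst nn_integral_add) (auto simp: nn_integral_suminf nn_integral_cmult emeasure_space_1)
  also have "\<dots> \<le> ennreal (L\<^sup>2) + (\<Sum>j. ennreal (L\<^sup>2 * ((10 ^ 5) ^ (2 * Suc j) * (2 / 7) ^ (9 ^ j))))"
  proof (intro add_left_mono suminf_le)
    fix j
    have "ennreal (w j) * emeasure M (S j) = ennreal (w j * prob (S j))"
      by (simp add: emeasure_eq_measure ennreal_mult[symmetric] w_def)
    also have "\<dots> \<le> ennreal (w j * (2 / 7) ^ (9 ^ j))"
      unfolding S_def P_def using quad_tail[OF less_imp_le[OF L] q]
      by (intro ennreal_leI mult_left_mono) (auto simp: w_def)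
    also have "w j * (2 / 7) ^ (9 ^ j) = L\<^sup>2 * ((10 ^ 5) ^ (2 * Suc j) * (2 / 7) ^ (9 ^ j))"
    proof -
      have "w j = (10 ^ 5) ^ (2 * Suc j) * L\<^sup>2"
        unfolding w_def power_mult_distrib using power_mult[of "10 ^ 5 :: real" "Suc j" 2]
        by (simp only: mult.commute)
      then show ?thesis by (simp only: ac_simps)
    qed
    finally show "ennreal (w j) * emeasure M (S j) \<le> ennreal (L\<^sup>2 * ((10 ^ 5) ^ (2 * Suc j) * (2 / 7) ^ (9 ^ j)))" .
  qed auto
  also have "\<dots> = ennreal (L\<^sup>2) + ennreal (\<Sum>j. L\<^sup>2 * ((10 ^ 5) ^ (2 * Suc j) * (2 / 7) ^ (9 ^ j)))"
    by (subst suminf_ennreal2[OF _ summable_mult[OF summable_second_moment_const]]) auto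
  also have "\<dots> = ennreal (second_moment_const * L\<^sup>2)"
  proof -
    have "0 \<le> (\<Sum>j. (10 ^ 5) ^ (2 * Suc j) * (2 / 7 :: real) ^ (9 ^ j))"
      by (intro suminf_nonneg summable_second_moment_const) auto
    then show ?thesis
      unfolding second_moment_const_def suminf_mult[OF summable_second_moment_const]
      by (subst ennreal_plus[symmetric]) (auto simp: algebra_simps simp del: ennreal_plus)
  qed
  finally show ?thesis by (simp add: P_def)
qed

lemma quad_square_integrable: "integrable M (\<lambda>x. (quad n A x)\<^sup>2)"
proof -
  obtain q where q: "3 / 4 \<le> prob {x\<in>space M. \<bar>quad n A x\<bar> \<le> q}"
    using quantile_exists[of "\<lambda>x. \<bar>quad n A x\<bar>" "3 / 4"] by auto
  let ?L = "max q 1"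
  have "prob {x\<in>space M. \<bar>quad n A x\<bar> \<le> q} \<le> prob {x\<in>space M. \<bar>quad n A x\<bar> \<le> ?L}"
    by (intro finite_measure_mono) auto
  moreover have "prob {x\<in>space M. ?L < \<bar>quad n A x - 0\<bar>} = 1 - prob {x\<in>space M. \<bar>quad n A x\<bar> \<le> ?L}"
    by (subst prob_compl[symmetric]) (auto intro!: arg_cong[where f = prob])
  ultimately have "prob {x\<in>space M. ?L < \<bar>quad n A x - 0\<bar>} \<le> 1 / 4" using q by simp
  then have "(\<integral>\<^sup>+x. ennreal ((quad n A x)\<^sup>2) \<partial>M) \<le> ennreal (second_moment_const * ?L\<^sup>2)"
    using quad_second_moment[of ?L A 0] by simp
  then show ?thesis
    by (intro integrableI_bounded) (auto intro: le_less_trans)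
qed

lemma quad_integrable: "integrable M (quad n A)"
  using quad_square_integrable by (rule square_integrable_imp_integrable[rotated]) simp

text \<open>
  Let $m$ be a median of $Q$ and $L$ the $3/4$-quantile of $|Q - m|$. The tail bound gives a variance of
  at most a constant times $L^2$. In the other direction \<open>quad_dilation\<close> turns
  $\mathrm{P}(|Q - m| > L/2) > 1/4$ into $\mathrm{P}(|Q - m| \le l) \le 1/4$ for
  $l = L / (2 \cdot 10^5)$. As $\{Q \le m\}$ has measure at least $1/2$, at least $1/4$
  remains for $\{Q \le m - l\}$. In this way the upper tail of $Q$, on which ellipsoids say nothing, is controlled by the lower one.
\<close>

lemma quad_lower_deviation:
  obtains m l where "0 \<le> l" "variance (quad n A) \<le> second_moment_const * (2 * 10 ^ 5 * l)\<^sup>2"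
    "\<And>s. m - l \<le> s \<Longrightarrow> s < m \<Longrightarrow> 1 / 4 \<le> prob {x\<in>space M. quad n A x \<le> s} \<and> prob {x\<in>space M. quad n A x \<le> s} \<le> 1 / 2"
proof -
  obtain m where m: "1 / 2 \<le> prob {x\<in>space M. quad n A x \<le> m}"
    "\<And>s. s < m \<Longrightarrow> prob {x\<in>space M. quad n A x \<le> s} < 1 / 2"
    using quantile_exists[of "quad n A" "1 / 2"] by auto
  define P where "P x = quad n A x - m" for x
  have [measurable]: "P \<in> borel_measurable M" unfolding P_def by measurable
  have compl: "prob {x\<in>space M. s < \<bar>P x\<bar>} = 1 - prob {x\<in>space M. \<bar>P x\<bar> \<le> s}" for s
    by (subst prob_compl[symmetric]) (auto intro!: arg_cong[where f = prob])
  obtain L where L: "3 / 4 \<le> prob {x\<in>space M. \<bar>P x\<bar> \<le> L}"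
    "\<And>s. s < L \<Longrightarrow> prob {x\<in>space M. \<bar>P x\<bar> \<le> s} < 3 / 4"
    using quantile_exists[of "\<lambda>x. \<bar>P x\<bar>" "3 / 4"] by auto
  have L0: "0 \<le> L"
  proof (rule ccontr)
    assume "\<not> 0 \<le> L"
    then have "{x\<in>space M. \<bar>P x\<bar> \<le> L} = {}" by auto
    then have "prob {x\<in>space M. \<bar>P x\<bar> \<le> L} = 0" by (simp only: measure_empty)
    then show False using L(1) by linarith
  qed
  have intP: "integrable M (\<lambda>x. (P x)\<^sup>2)"
    unfolding P_def power2_diff using quad_square_integrable quad_integrable by auto
  have "variance (quad n A) \<le> expectation (\<lambda>x. (P x)\<^sup>2)"
  proof -
    have "expectation (\<lambda>x. (P x)\<^sup>2) = expectation (\<lambda>x. (quad n A x)\<^sup>2) - 2 * m * expectation (quad n A) + m\<^sup>2"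
      unfolding P_def power2_diff using quad_square_integrable quad_integrable by (simp add: prob_space mult.commute mult.left_commute)
    moreover have "variance (quad n A) = expectation (\<lambda>x. (quad n A x)\<^sup>2) - (expectation (quad n A))\<^sup>2"
      by (rule variance_eq[OF quad_integrable quad_square_integrable])
    ultimately have "expectation (\<lambda>x. (P x)\<^sup>2) - variance (quad n A) = (expectation (quad n A) - m)\<^sup>2"
      by (simp add: power2_diff)
    then show ?thesis by (metis diff_ge_0_iff_ge zero_le_power2)
  qed
  moreover have moment: "expectation (\<lambda>x. (P x)\<^sup>2) \<le> second_moment_const * s\<^sup>2" if s: "L \<le> s" "0 < s" for s
  proof -
    have "prob {x\<in>space M. \<bar>P x\<bar> \<le> L} \<le> prob {x\<in>space M. \<bar>P x\<bar> \<le> s}"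
      using s by (intro finite_measure_mono) auto
    then have "prob {x\<in>space M. s < \<bar>P x\<bar>} \<le> 1 / 4" using L(1) by (simp add: compl)
    then have "(\<integral>\<^sup>+x. ennreal ((P x)\<^sup>2) \<partial>M) \<le> ennreal (second_moment_const * s\<^sup>2)"
      unfolding P_def by (rule quad_second_moment[OF s(2)])
    then show ?thesis
      using second_moment_const_pos by (subst (asm) nn_integral_eq_integral[OF intP]) (auto simp: ennreal_le_iff)
  qed
  ultimately have var: "variance (quad n A) \<le> second_moment_const * s\<^sup>2" if "L \<le> s" "0 < s" for s
    using that by (meson order_trans)
  show thesis
  proof (cases "L = 0")
    case True
    have "variance (quad n A) \<le> 0"
    proof (rule field_le_epsilon)
      fix e :: real assume e: "0 < e"
      have "variance (quad n A) \<le> second_moment_const * (sqrt (e / second_moment_const))\<^sup>2"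
        using e second_moment_const_pos True by (intro var) auto
      then show "variance (quad n A) \<le> 0 + e" using e second_moment_const_pos by simp
    qed
    then show thesis by (intro that[of 0 m]) auto
  next
    case False
    define l where "l = L / (2 * 10 ^ 5)"
    have l: "0 < l" "10 ^ 5 * l = L / 2" "2 * 10 ^ 5 * l = L" "l \<le> L" using False L0 by (auto simp: l_def)
    have "1 / 4 < prob {x\<in>space M. 10 ^ 5 * l < \<bar>P x\<bar>}"
      unfolding l(2) compl using L(2)[of "L / 2"] False L0 by auto
    then have "(1 / 4) powr (1 / 10) \<le> prob {x\<in>space M. 10 ^ 5 * l < \<bar>P x\<bar>} powr (1 / 10)"
      by (intro powr_mono2) auto
    also have "\<dots> \<le> 8 / 7 * prob {x\<in>space M. l < \<bar>P x\<bar>}"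
      unfolding P_def using l by (intro quad_dilation) auto
    finally have 1: "(1 / 4) powr (1 / 10) \<le> 8 / 7 * prob {x\<in>space M. l < \<bar>P x\<bar>}" .
    have "(6 / 7 :: real) ^ 10 = (6 / 7) powr 10" by simp
    then have "((6 / 7) ^ 10) powr (1 / 10 :: real) = (6 / 7) powr (10 * (1 / 10))"
      by (simp only: powr_powr)
    then have "6 / 7 = ((6 / 7) ^ 10) powr (1 / 10 :: real)" by simp
    also have "\<dots> \<le> (1 / 4) powr (1 / 10)"
      by (intro powr_mono2) (auto simp: field_simps)
    finally have small: "prob {x\<in>space M. \<bar>P x\<bar> \<le> l} \<le> 1 / 4"
      using 1 by (simp add: compl)
    have low: "1 / 4 \<le> prob {x\<in>space M. quad n A x \<le> s}" if s: "m - l \<le> s" for s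
    proof -
      have "prob {x\<in>space M. quad n A x \<le> m} \<le> prob ({x\<in>space M. quad n A x \<le> s} \<union> {x\<in>space M. \<bar>P x\<bar> \<le> l})"
        using s by (intro finite_measure_mono) (auto simp: P_def)
      also have "\<dots> \<le> prob {x\<in>space M. quad n A x \<le> s} + prob {x\<in>space M. \<bar>P x\<bar> \<le> l}"
        by (intro measure_Un_le) auto
      finally show ?thesis using m(1) small by simp
    qed
    show thesis
      using l low m(2) var[of L] False L0
      by (intro that[of l m]) (auto intro: less_imp_le)
  qed
qed

end

section \<open>Symmetric matrices and quadratic forms\<close>

definition frob :: "nat \<Rightarrow> (nat \<Rightarrow> nat \<Rightarrow> real) \<Rightarrow> real" where
  "frob n A = (\<Sum>i<n. \<Sum>j<n. (A i j)\<^sup>2)"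

definition grad_quad :: "nat \<Rightarrow> (nat \<Rightarrow> nat \<Rightarrow> real) \<Rightarrow> (nat \<Rightarrow> real) \<Rightarrow> nat \<Rightarrow> real" where
  "grad_quad n A x i = 2 * (\<Sum>j<n. A i j * x j)"

abbreviation pos_def :: "nat \<Rightarrow> (nat \<Rightarrow> nat \<Rightarrow> real) \<Rightarrow> bool" where
  "pos_def n A \<equiv> \<forall>v. (\<exists>i<n. v i \<noteq> 0) \<longrightarrow> 0 < quad n A v"

lemma quad_add:
  assumes sym: "\<And>i j. A i j = A j i"
  shows "quad n A (\<lambda>i. x i + h i) = quad n A x + (\<Sum>i<n. grad_quad n A x i * h i) + quad n A h"
proof -
  have "(\<Sum>i<n. \<Sum>j<n. A i j * x i * h j) = (\<Sum>i<n. \<Sum>j<n. A i j * x j * h i)"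
    by (subst sum.swap) (simp add: sym[of _ _] mult.commute mult.left_commute cong: sum.cong)
  moreover have "quad n A (\<lambda>i. x i + h i) = quad n A x + (\<Sum>i<n. \<Sum>j<n. A i j * x i * h j)
      + (\<Sum>i<n. \<Sum>j<n. A i j * x j * h i) + quad n A h"
    unfolding quad_def sum.distrib[symmetric] by (intro sum.cong refl) (simp add: algebra_simps)
  moreover have "(\<Sum>i<n. grad_quad n A x i * h i) = 2 * (\<Sum>i<n. \<Sum>j<n. A i j * x j * h i)"
    by (simp add: grad_quad_def sum_distrib_left sum_distrib_right mult.assoc)
  ultimately show ?thesis by simp
qed

lemma gradient_quadratic_form:
  assumes sym: "\<And>i j. A i j = A j i" and Q: "\<And>x. x \<in> Rn n \<Longrightarrow> Q x = quad n A x"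
    and x: "x \<in> Rn n" and i: "i < n"
  shows "gradient Q x i = grad_quad n A x i"
proof -
  have "Q (x(i := t)) = quad n A x + grad_quad n A x i * (t - x i) + A i i * (t - x i)\<^sup>2" for t
  proof -
    let ?h = "\<lambda>j. if j = i then t - x i else 0"
    have "x(i := t) \<in> Rn n" using x i by (auto simp: Rn_def PiE_def extensional_def)
    then have "Q (x(i := t)) = quad n A (x(i := t))" by (rule Q)
    also have "quad n A (x(i := t)) = quad n A (\<lambda>j. x j + ?h j)"
      by (rule arg_cong[where f = "quad n A"]) auto
    also have "\<dots> = quad n A x + (\<Sum>j<n. grad_quad n A x j * ?h j) + quad n A ?h"
      by (rule quad_add[OF sym])
    also have "(\<Sum>j<n. grad_quad n A x j * ?h j) = grad_quad n A x i * (t - x i)"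
      using i by (simp add: if_distrib[of "\<lambda>u. _ * u"] sum.delta cong: if_cong)
    also have "quad n A ?h = A i i * (t - x i)\<^sup>2"
      using i by (simp add: quad_def if_distrib[of "\<lambda>u. _ * u"] if_distrib[of "\<lambda>u. u * _"] sum.delta power2_eq_square cong: if_cong)
    finally show ?thesis .
  qed
  then have "(\<lambda>t. Q (x(i := t))) = (\<lambda>t. quad n A x + grad_quad n A x i * (t - x i) + A i i * (t - x i)\<^sup>2)"
    by (rule ext)
  moreover have "((\<lambda>t. quad n A x + grad_quad n A x i * (t - x i) + A i i * (t - x i)\<^sup>2)
      has_field_derivative grad_quad n A x i) (at (x i))"
    by (auto intro!: derivative_eq_intros)
  ultimately show ?thesis by (simp add: gradient_def DERIV_imp_deriv)
qed

lemma L2_set_gradient: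
  assumes "\<And>i j. A i j = A j i" "\<And>x. x \<in> Rn n \<Longrightarrow> Q x = quad n A x" "x \<in> Rn n"
  shows "L2_set (gradient Q x) {..<n} = L2_set (grad_quad n A x) {..<n}"
  using gradient_quadratic_form[OF assms] by (simp add: L2_set_def)

lemma quad_drop_le:
  assumes sym: "\<And>i j. A i j = A j i" and nonneg: "\<And>v. 0 \<le> quad n A v"
  shows "quad n A x - L2_set (grad_quad n A x) {..<n} * dist_Rn n x y \<le> quad n A y"
proof -
  have "quad n A y = quad n A (\<lambda>i. x i + (y i - x i))" by simp
  also have "\<dots> = quad n A x + (\<Sum>i<n. grad_quad n A x i * (y i - x i)) + quad n A (\<lambda>i. y i - x i)"
    by (rule quad_add[OF sym])
  finally have 1: "quad n A x + (\<Sum>i<n. grad_quad n A x i * (y i - x i)) \<le> quad n A y"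
    using nonneg[of "\<lambda>i. y i - x i"] by simp
  have "- (\<Sum>i<n. grad_quad n A x i * (y i - x i)) = (\<Sum>i<n. grad_quad n A x i * (x i - y i))"
    by (simp add: sum_negf[symmetric] algebra_simps)
  also have "\<dots> \<le> (\<Sum>i<n. \<bar>grad_quad n A x i\<bar> * \<bar>x i - y i\<bar>)"
    by (intro sum_mono) (auto simp: abs_mult[symmetric])
  also have "\<dots> \<le> L2_set (grad_quad n A x) {..<n} * dist_Rn n x y"
    unfolding dist_Rn_def by (rule L2_set_mult_ineq)
  finally show ?thesis using 1 by linarith
qed

lemma frob_nonneg: "0 \<le> frob n A" by (simp add: frob_def sum_nonneg)

lemma frob_add_le: "frob n (\<lambda>i j. A i j + B i j) \<le> 2 * frob n A + 2 * frob n B"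
proof -
  have "frob n (\<lambda>i j. A i j + B i j) \<le> (\<Sum>i<n. \<Sum>j<n. 2 * (A i j)\<^sup>2 + 2 * (B i j)\<^sup>2)"
    unfolding frob_def
  proof (intro sum_mono)
    fix i j
    have "0 \<le> (A i j - B i j)\<^sup>2" by simp
    then show "(A i j + B i j)\<^sup>2 \<le> 2 * (A i j)\<^sup>2 + 2 * (B i j)\<^sup>2"
      by (simp add: power2_sum power2_diff)
  qed
  then show ?thesis by (simp add: frob_def sum.distrib sum_distrib_left)
qed

text \<open>
  In the Frobenius norm, let $B$ be a positive semidefinite matrix whose squared distance to $A$ is
  minimal up to $e^2$. Replacing $B$ by $B + s v v^T$ stays in the cone, hence lowers the squared
  distance by at most $e^2$; for $s = e / |v|^2$ this bounds the form of $A - B$ at $v$. An exact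
  nearest point would give $A \le B$. The approximate one is enough because a multiple of the identity
  is added afterwards anyway, and it exists without a compactness argument.
\<close>

lemma psd_approx_projection:
  assumes symA: "\<And>i j. A i j = A j i" and e: "0 < e"
  obtains B where "\<And>i j. B i j = B j i" "\<And>v. 0 \<le> quad n B v"
    "frob n (\<lambda>i j. A i j - B i j) \<le> frob n A + e\<^sup>2"
    "\<And>v. quad n (\<lambda>i j. A i j - B i j) v \<le> e * (\<Sum>i<n. (v i)\<^sup>2)"
proof -
  define PSD where "PSD = {B. (\<forall>i j. B i j = B j i) \<and> (\<forall>v. 0 \<le> quad n B v)}"
  define F where "F B = frob n (\<lambda>i j. A i j - B i j)" for B
  define d where "d = (INF B\<in>PSD. F B)"
  have zero: "(\<lambda>_ _. 0) \<in> PSD" by (simp add: PSD_def quad_def)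
  have bdd: "bdd_below (F ` PSD)" by (intro bdd_belowI2[of _ 0]) (simp add: F_def frob_nonneg)
  have d_le: "d \<le> F B" if "B \<in> PSD" for B
    unfolding d_def using bdd that by (rule cINF_lower)
  have "d < d + e\<^sup>2" using e by simp
  then obtain B where B: "B \<in> PSD" "F B < d + e\<^sup>2"
    unfolding d_def using bdd zero cINF_less_iff[of PSD F "d + e\<^sup>2"] by (auto simp: d_def)
  have "quad n (\<lambda>i j. A i j - B i j) v \<le> e * (\<Sum>i<n. (v i)\<^sup>2)" for v
  proof (cases "(\<Sum>i<n. (v i)\<^sup>2) = 0")
    case True
    then have "v i = 0" if "i < n" for i using that by (simp add: sum_nonneg_eq_0_iff)
    then show ?thesis using True by (simp add: quad_def)
  next
    case False
    define N where "N = (\<Sum>i<n. (v i)\<^sup>2)"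
    have N: "0 < N" using False by (simp add: N_def less_le sum_nonneg)
    define s where "s = e / N"
    have s: "0 < s" "s * N = e" using N e by (simp_all add: s_def)
    let ?B = "\<lambda>i j. B i j + s * (v i * v j)"
    have rank1: "quad n (\<lambda>i j. v i * v j) w = (\<Sum>i<n. v i * w i)\<^sup>2" for w
      by (simp add: quad_def power2_eq_square sum_product algebra_simps)
    have "quad n ?B w = quad n B w + s * quad n (\<lambda>i j. v i * v j) w" for w
      by (simp add: quad_def sum_distrib_left sum.distrib[symmetric] algebra_simps)
    then have "?B \<in> PSD" using B(1) s unfolding PSD_def by (auto simp: rank1 mult.commute)
    then have "d \<le> F ?B" by (rule d_le)
    moreover have "F ?B = F B - 2 * s * quad n (\<lambda>i j. A i j - B i j) v + s\<^sup>2 * N\<^sup>2"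
    proof -
      have N2: "N\<^sup>2 = (\<Sum>i<n. \<Sum>j<n. (v i)\<^sup>2 * (v j)\<^sup>2)"
        by (simp add: N_def power2_eq_square sum_product)
      show ?thesis
        unfolding F_def frob_def quad_def N2 sum_distrib_left sum_subtractf[symmetric] sum.distrib[symmetric]
        by (intro sum.cong refl) (simp add: power2_eq_square algebra_simps)
    qed
    ultimately have "2 * s * quad n (\<lambda>i j. A i j - B i j) v < e\<^sup>2 + (s * N)\<^sup>2"
      using B(2) by (simp add: power_mult_distrib)
    moreover have "s * (e * N) = e\<^sup>2"
    proof -
      have "s * (e * N) = (s * N) * e" by (simp only: ac_simps)
      then show ?thesis by (simp only: s(2) power2_eq_square)
    qed
    ultimately have "s * quad n (\<lambda>i j. A i j - B i j) v \<le> s * (e * N)"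
      by (simp only: s(2))
    then show ?thesis using s(1) by (simp add: N_def)
  qed
  moreover have "F B \<le> frob n A + e\<^sup>2"
    using B(2) d_le[OF zero] by (simp add: F_def)
  ultimately show thesis using B(1) that[of B] by (simp add: PSD_def F_def)
qed

text \<open>
  The positive and negative parts of $A$ up to a small multiple of the identity. They come from the
  projection onto the cone of positive semidefinite matrices instead of the spectral theorem; the
  essential point is that the Frobenius norms stay bounded independently of the dimension, which a shift
  of $A$ by its largest eigenvalue would not achieve.
\<close>

lemma pos_def_difference:
  assumes symA: "\<And>i j. A i j = A j i" and A: "0 < frob n A"
  obtains B C where "\<And>i j. B i j = B j i" "\<And>i j. C i j = C j i" "pos_def n B" "pos_def n C"
    "\<And>i j. A i j = B i j - C i j" "frob n B \<le> 26 * frob n A" "frob n C \<le> 26 * frob n A"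
proof -
  \<comment> \<open>This makes the Frobenius norm of \<open>e\<close> times the identity at most that of \<open>A\<close>.\<close>
  define e where "e = sqrt (frob n A / (real n + 1))"
  have e: "0 < e" "e\<^sup>2 * (real n + 1) = frob n A" using A by (simp_all add: e_def)
  have e1: "e\<^sup>2 \<le> frob n A" "e\<^sup>2 * real n \<le> frob n A"
  proof -
    have "e\<^sup>2 * real n + e\<^sup>2 = frob n A" using e(2) by (simp add: algebra_simps)
    moreover have "0 \<le> e\<^sup>2 * real n" "0 \<le> e\<^sup>2" by simp_all
    ultimately show "e\<^sup>2 \<le> frob n A" "e\<^sup>2 * real n \<le> frob n A" by linarith+
  qed
  obtain B where B: "\<And>i j. B i j = B j i" "\<And>v. 0 \<le> quad n B v"
    "frob n (\<lambda>i j. A i j - B i j) \<le> frob n A + e\<^sup>2"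
    "\<And>v. quad n (\<lambda>i j. A i j - B i j) v \<le> e * (\<Sum>i<n. (v i)\<^sup>2)"
    by (rule psd_approx_projection[OF symA e(1)]) (rule that)
  define D where "D i j = (if i = j then 2 * e else 0)" for i j :: nat
  define B' where "B' i j = B i j + D i j" for i j
  define C' where "C' i j = B i j - A i j + D i j" for i j
  have quadD: "quad n D v = 2 * e * (\<Sum>i<n. (v i)\<^sup>2)" for v
    by (simp add: quad_def D_def if_distrib[of "\<lambda>u. u * _"] sum.delta sum_distrib_left power2_eq_square mult.assoc cong: if_cong)
  have frobD: "frob n D = 4 * (e\<^sup>2 * real n)"
    by (simp add: frob_def D_def if_distrib[of "\<lambda>u. u\<^sup>2"] sum.delta power_mult_distrib cong: if_cong)
  have pos: "0 < (\<Sum>i<n. (v i)\<^sup>2)" if "\<exists>i<n. v i \<noteq> 0" for v :: "nat \<Rightarrow> real"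
    using that by (auto intro!: sum_pos2)
  have fC: "frob n C' \<le> 12 * frob n A"
  proof -
    have "frob n C' = frob n (\<lambda>i j. (B i j - A i j) + D i j)" by (simp add: C'_def[abs_def])
    also have "\<dots> \<le> 2 * frob n (\<lambda>i j. B i j - A i j) + 2 * frob n D" by (rule frob_add_le)
    also have "frob n (\<lambda>i j. B i j - A i j) = frob n (\<lambda>i j. A i j - B i j)"
      by (simp add: frob_def power2_commute)
    finally show ?thesis using B(3) frobD e1 by linarith
  qed
  have fB: "frob n B' \<le> 26 * frob n A"
  proof -
    have "frob n B' = frob n (\<lambda>i j. A i j + C' i j)" by (simp add: C'_def[abs_def] B'_def[abs_def])
    also have "\<dots> \<le> 2 * frob n A + 2 * frob n C'" by (rule frob_add_le)
    finally show ?thesis using fC by linarith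
  qed
  show thesis
  proof (rule that[of B' C'])
    show "B' i j = B' j i" "C' i j = C' j i" for i j using B(1)[of i j] symA[of i j] by (simp_all add: B'_def C'_def D_def)
    show "A i j = B' i j - C' i j" for i j by (simp add: B'_def C'_def)
    show "frob n B' \<le> 26 * frob n A" "frob n C' \<le> 26 * frob n A" using fB fC frob_nonneg[of n A] by linarith+
    have quadB: "quad n B' v = quad n B v + quad n D v" for v
      unfolding quad_def B'_def sum.distrib[symmetric] by (intro sum.cong refl) (simp add: algebra_simps)
    have quadC: "quad n C' v = quad n D v - quad n (\<lambda>i j. A i j - B i j) v" for v
      unfolding quad_def C'_def sum_subtractf[symmetric] by (intro sum.cong refl) (simp add: algebra_simps)
    show "pos_def n B'"
    proof (intro allI impI)
      fix v :: "nat \<Rightarrow> real" assume "\<exists>i<n. v i \<noteq> 0"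
      then have "0 < e * (\<Sum>i<n. (v i)\<^sup>2)" using pos e(1) by simp
      then show "0 < quad n B' v" using B(2)[of v] quadB[of v] quadD[of v] by linarith
    qed
    show "pos_def n C'"
    proof (intro allI impI)
      fix v :: "nat \<Rightarrow> real" assume "\<exists>i<n. v i \<noteq> 0"
      then have "0 < e * (\<Sum>i<n. (v i)\<^sup>2)" using pos e(1) by simp
      then show "0 < quad n C' v" using B(4)[of v] quadC[of v] quadD[of v] by linarith
    qed
  qed
qed

section \<open>Isoperimetry of ellipsoids and the deviation of positive definite forms\<close>

lemma Liminf_at_right_le_liminf:
  fixes f :: "real \<Rightarrow> ennreal"
  shows "Liminf (at_right 0) f \<le> liminf (\<lambda>k. f (1 / real (Suc k)))"
proof -
  have "filterlim (\<lambda>k. 1 / real (Suc k)) (at_right 0) sequentially"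
    unfolding filterlim_at using LIMSEQ_inverse_real_of_nat by (auto simp: inverse_eq_divide)
  then have le: "filtermap (\<lambda>k. 1 / real (Suc k)) sequentially \<le> at_right 0" by (simp add: filterlim_def)
  have "Liminf (at_right 0) f \<le> Liminf (filtermap (\<lambda>k. 1 / real (Suc k)) sequentially) f"
    unfolding Liminf_def using filter_leD[OF le] by (intro SUP_subset_mono) auto
  also have "\<dots> \<le> liminf (\<lambda>k. f (1 / real (Suc k)))" by (rule Liminf_filtermap_le)
  finally show ?thesis .
qed

text \<open>
  A nonnegative form is convex, so within distance $\varepsilon$ of $x$ it falls below $Q(x)$ by at
  most $\varepsilon |\nabla Q(x)|$. Enlarging a sublevel set therefore only adds points of the layer
  on the right-hand side, whose measure is easy to integrate over the level $s$.
\<close>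

lemma boundary_measure_sublevel_le:
  fixes M :: "(nat \<Rightarrow> real) measure"
  assumes M: "finite_measure M" "space M = Rn n"
    and Q[measurable]: "quad n A \<in> borel_measurable M"
    and g[measurable]: "(\<lambda>x. L2_set (grad_quad n A x) {..<n}) \<in> borel_measurable M"
    and sym: "\<And>i j. A i j = A j i" and nonneg: "\<And>v. 0 \<le> quad n A v"
  shows "boundary_measure n M {x\<in>Rn n. quad n A x \<le> s} \<le>
    liminf (\<lambda>k. ennreal (Suc k) * emeasure M {x\<in>space M.
      quad n A x - 1 / Suc k * L2_set (grad_quad n A x) {..<n} \<le> s \<and> s < quad n A x})"
proof -
  interpret finite_measure M by fact
  let ?g = "\<lambda>x. L2_set (grad_quad n A x) {..<n}"
  let ?E = "{x\<in>Rn n. quad n A x \<le> s}"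
  let ?D = "\<lambda>e. {x\<in>space M. quad n A x - e * ?g x \<le> s \<and> s < quad n A x}"
  have "ennreal ((measure M (enlargement n e ?E) - measure M ?E) / e) \<le> ennreal (1 / e) * emeasure M (?D e)"
    if e: "0 < e" for e
  proof -
    have "enlargement n e ?E \<subseteq> ?E \<union> ?D e"
    proof
      fix x assume "x \<in> enlargement n e ?E"
      then obtain y where xy: "x \<in> Rn n" "quad n A y \<le> s" "dist_Rn n x y \<le> e"
        by (auto simp: enlargement_def)
      have "quad n A x - e * ?g x \<le> quad n A x - ?g x * dist_Rn n x y"
        using mult_left_mono[OF xy(3), of "?g x"] by (simp add: mult.commute)
      also have "\<dots> \<le> quad n A y" by (rule quad_drop_le[OF sym nonneg])
      finally show "x \<in> ?E \<union> ?D e" using xy by (auto simp: M(2))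
    qed
    then have "measure M (enlargement n e ?E) \<le> measure M (?E \<union> ?D e)"
      unfolding M(2)[symmetric] by (intro finite_measure_mono) auto
    also have "\<dots> \<le> measure M ?E + measure M (?D e)"
      unfolding M(2)[symmetric] by (intro measure_Un_le) auto
    finally have "(measure M (enlargement n e ?E) - measure M ?E) / e \<le> 1 / e * measure M (?D e)"
      using e by (simp add: divide_right_mono)
    then have "ennreal ((measure M (enlargement n e ?E) - measure M ?E) / e) \<le> ennreal (1 / e * measure M (?D e))"
      by (rule ennreal_leI)
    also have "\<dots> = ennreal (1 / e) * emeasure M (?D e)"
      using e by (simp add: emeasure_eq_measure ennreal_mult[symmetric])
    finally show ?thesis .
  qed
  then have "boundary_measure n M ?E \<le> Liminf (at_right 0) (\<lambda>e. ennreal (1 / e) * emeasure M (?D e))"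
    unfolding boundary_measure_def
    by (intro Liminf_mono) (auto simp: eventually_at_right_field intro!: exI[of _ 1])
  also have "\<dots> \<le> liminf (\<lambda>k. ennreal (1 / (1 / real (Suc k))) * emeasure M (?D (1 / real (Suc k))))"
    by (rule Liminf_at_right_le_liminf)
  finally show ?thesis by (simp add: M(2))
qed

text \<open>
  Tonelli's theorem: for fixed $x$ the levels $s$ whose layer contains $x$ form an interval of length
  $\varepsilon g(x)$. With $g = |\nabla Q|$ this takes the place of the coarea formula.
\<close>

lemma nn_integral_layer:
  fixes Q g :: "'a \<Rightarrow> real"
  assumes M: "sigma_finite_measure M"
    and [measurable]: "Q \<in> borel_measurable M" "g \<in> borel_measurable M"
    and g: "\<And>x. 0 \<le> g x" and e: "0 < e"
  shows "(\<integral>\<^sup>+s. emeasure M {x\<in>space M. Q x - e * g x \<le> s \<and> s < Q x} \<partial>lborel)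
    = ennreal e * (\<integral>\<^sup>+x. ennreal (g x) \<partial>M)"
    and "(\<lambda>s. emeasure M {x\<in>space M. Q x - e * g x \<le> s \<and> s < Q x}) \<in> borel_measurable borel"
proof -
  interpret sigma_finite_measure M by fact
  interpret pair_sigma_finite M lborel by standard
  define h where "h z = (indicator {z. Q (fst z) - e * g (fst z) \<le> snd z \<and> snd z < Q (fst z)} z :: ennreal)" for z
  have h[measurable]: "h \<in> borel_measurable (M \<Otimes>\<^sub>M lborel)"
    unfolding h_def[abs_def] indicator_def[abs_def] by simp
  have 1: "emeasure M {x\<in>space M. Q x - e * g x \<le> s \<and> s < Q x} = (\<integral>\<^sup>+x. h (x, s) \<partial>M)" for s
  proof -
    have "(\<integral>\<^sup>+x. h (x, s) \<partial>M) = (\<integral>\<^sup>+x. indicator {x\<in>space M. Q x - e * g x \<le> s \<and> s < Q x} x \<partial>M)"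
      by (intro nn_integral_cong) (auto simp: h_def indicator_def)
    then show ?thesis by simp
  qed
  have 2: "(\<integral>\<^sup>+s. h (x, s) \<partial>lborel) = ennreal (e * g x)" for x
  proof -
    have "(\<integral>\<^sup>+s. h (x, s) \<partial>lborel) = (\<integral>\<^sup>+s. indicator {Q x - e * g x..<Q x} s \<partial>lborel)"
      by (intro nn_integral_cong) (auto simp: h_def indicator_def)
    then show ?thesis using e g[of x] by simp
  qed
  have "(\<integral>\<^sup>+s. (\<integral>\<^sup>+x. h (x, s) \<partial>M) \<partial>lborel) = (\<integral>\<^sup>+x. (\<integral>\<^sup>+s. h (x, s) \<partial>lborel) \<partial>M)"
    by (rule Fubini[OF h])
  also have "\<dots> = (\<integral>\<^sup>+x. ennreal e * ennreal (g x) \<partial>M)"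
    using e g by (simp add: 2 ennreal_mult)
  also have "\<dots> = ennreal e * (\<integral>\<^sup>+x. ennreal (g x) \<partial>M)" by (rule nn_integral_cmult) simp
  finally show "(\<integral>\<^sup>+s. emeasure M {x\<in>space M. Q x - e * g x \<le> s \<and> s < Q x} \<partial>lborel)
    = ennreal e * (\<integral>\<^sup>+x. ennreal (g x) \<partial>M)" by (simp only: 1)
  have "(\<lambda>z. h (snd z, fst z)) \<in> borel_measurable (borel \<Otimes>\<^sub>M M)"
    by (rule measurable_compose[OF _ h]) measurable
  then have "(\<lambda>s. \<integral>\<^sup>+x. h (x, s) \<partial>M) \<in> borel_measurable borel"
    by (intro sigma_finite_measure.borel_measurable_nn_integral[OF M]) (simp add: case_prod_beta')
  then show "(\<lambda>s. emeasure M {x\<in>space M. Q x - e * g x \<le> s \<and> s < Q x}) \<in> borel_measurable borel"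
    by (simp only: 1)
qed

lemma ellipsoid_sublevel:
  assumes sym: "\<And>i j. A i j = A j i" and pd: "pos_def n A" and s: "0 < s"
  shows "ellipsoid n {x\<in>Rn n. quad n A x \<le> s}"
  unfolding ellipsoid_def
proof (intro bexI exI conjI)
  let ?c = "\<lambda>i\<in>{..<n}. 0 :: real" and ?A = "\<lambda>i j. A i j / s"
  show "?c \<in> Rn n" by (auto simp: Rn_def)
  show "\<forall>i<n. \<forall>j<n. ?A i j = ?A j i" using sym by simp
  have eq: "(\<Sum>i<n. \<Sum>j<n. ?A i j * v i * v j) = quad n A v / s" for v
    by (simp add: quad_def sum_divide_distrib)
  show "\<forall>v\<in>Rn n. (\<exists>i<n. v i \<noteq> 0) \<longrightarrow> 0 < (\<Sum>i<n. \<Sum>j<n. ?A i j * v i * v j)"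
    unfolding eq using pd s by auto
  have eq': "(\<Sum>i<n. \<Sum>j<n. ?A i j * (x i - ?c i) * (x j - ?c j)) = quad n A x / s" for x
    unfolding eq[symmetric] by (intro sum.cong refl) auto
  show "{x\<in>Rn n. quad n A x \<le> s} =
      {x\<in>Rn n. (\<Sum>i<n. \<Sum>j<n. ?A i j * (x i - ?c i) * (x j - ?c j)) \<le> 1}"
    unfolding eq' using s by (auto simp: field_simps)
qed

locale isotropic_measure = log_concave_measure +
  assumes iso: "isotropic n M"
begin

text \<open>
  Products of two coordinates are quadratic forms, hence integrable and even square integrable.
\<close>

lemma quad_unit: "i < n \<Longrightarrow> j < n \<Longrightarrow> quad n (\<lambda>a b. if a = i \<and> b = j then 1 else 0) x = x i * x j"
proof -
  assume ij: "i < n" "j < n"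
  have "quad n (\<lambda>a b. if a = i \<and> b = j then 1 else 0) x
      = (\<Sum>a<n. \<Sum>b<n. if b = j then (if a = i then x i * x j else 0) else 0)"
    unfolding quad_def by (intro sum.cong refl) simp
  then show ?thesis using ij by (simp add: sum.delta)
qed

lemma coord_measurable [measurable]: "i < n \<Longrightarrow> (\<lambda>x. x i) \<in> borel_measurable M"
  using measurable_component_singleton[of i "{..<n}" "\<lambda>_. lborel :: real measure"]
  by (simp cong: measurable_cong_sets add: sets_M)

lemma coord_prod_integrable: "i < n \<Longrightarrow> j < n \<Longrightarrow> integrable M (\<lambda>x. x i * x j)"
  using quad_integrable[of "\<lambda>a b. if a = i \<and> b = j then 1 else 0"] by (simp add: quad_unit cong: Bochner_Integration.integrable_cong)

lemma coord_integrable: "i < n \<Longrightarrow> integrable M (\<lambda>x. x i)"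
proof -
  assume i: "i < n"
  then have "integrable M (\<lambda>x. (x i)\<^sup>2)"
    unfolding power2_eq_square by (intro coord_prod_integrable)
  then show ?thesis
    by (rule square_integrable_imp_integrable[rotated]) (rule coord_measurable[OF i])
qed

lemma coord_expectation: "i < n \<Longrightarrow> expectation (\<lambda>x. x i) = 0"
  using iso by (simp add: isotropic_def barycenter_def)

lemma coord_prod_expectation:
  "i < n \<Longrightarrow> j < n \<Longrightarrow> expectation (\<lambda>x. x i * x j) = (if i = j then 1 else 0)"
proof -
  assume ij: "i < n" "j < n"
  have "covariance M i j = (if i = j then 1 else 0)" "barycenter M i = 0" "barycenter M j = 0"
    using iso ij by (simp_all add: isotropic_def)
  then show ?thesis by (simp only: covariance_def diff_zero)
qed

lemma quad_expectation: "expectation (quad n A) = (\<Sum>i<n. A i i)"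
proof -
  have "expectation (quad n A) = (\<Sum>i<n. \<Sum>j<n. A i j * expectation (\<lambda>x. x i * x j))"
  proof -
    have "expectation (quad n A) = (\<Sum>i<n. expectation (\<lambda>x. \<Sum>j<n. A i j * (x i * x j)))"
      unfolding quad_def mult.assoc
      by (intro Bochner_Integration.integral_sum Bochner_Integration.integrable_sum
          integrable_mult_right coord_prod_integrable) auto
    also have "\<dots> = (\<Sum>i<n. \<Sum>j<n. expectation (\<lambda>x. A i j * (x i * x j)))"
      by (intro sum.cong refl Bochner_Integration.integral_sum integrable_mult_right coord_prod_integrable) auto
    finally show ?thesis by simp
  qed
  also have "\<dots> = (\<Sum>i<n. A i i)"
    by (intro sum.cong refl) (simp add: coord_prod_expectation if_distrib sum.delta cong: if_cong)
  finally show ?thesis .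
qed

lemma linear_square: "(\<Sum>i<n. a i * x i)\<^sup>2 = quad n (\<lambda>i j. a i * a j) x"
  by (simp add: quad_def power2_eq_square sum_product algebra_simps)

lemma measurable_grad_norm [measurable]: "(\<lambda>x. L2_set (grad_quad n A x) {..<n}) \<in> borel_measurable M"
  unfolding L2_set_def grad_quad_def by measurable

lemma grad_norm_square:
  "integrable M (\<lambda>x. (L2_set (grad_quad n A x) {..<n})\<^sup>2)"
  "expectation (\<lambda>x. (L2_set (grad_quad n A x) {..<n})\<^sup>2) = 4 * frob n A"
proof -
  have eq: "(L2_set (grad_quad n A x) {..<n})\<^sup>2 = (\<Sum>i<n. 4 * quad n (\<lambda>j k. A i j * A i k) x)" for x
    unfolding L2_set_def grad_quad_def linear_square[symmetric]
    by (subst real_sqrt_pow2) (auto intro!: sum_nonneg sum.cong simp: power_mult_distrib)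
  show "integrable M (\<lambda>x. (L2_set (grad_quad n A x) {..<n})\<^sup>2)"
    unfolding eq by (intro Bochner_Integration.integrable_sum integrable_mult_right quad_integrable)
  have "expectation (\<lambda>x. (L2_set (grad_quad n A x) {..<n})\<^sup>2) = (\<Sum>i<n. 4 * (\<Sum>j<n. A i j * A i j))"
    unfolding eq by (subst Bochner_Integration.integral_sum) (auto simp: quad_integrable quad_expectation)
  then show "expectation (\<lambda>x. (L2_set (grad_quad n A x) {..<n})\<^sup>2) = 4 * frob n A"
    by (simp add: frob_def power2_eq_square sum_distrib_left)
qed

lemma grad_norm_expectation:
  "(\<integral>\<^sup>+x. ennreal (L2_set (grad_quad n A x) {..<n}) \<partial>M) \<le> ennreal (2 * sqrt (frob n A))"
proof -
  let ?g = "\<lambda>x. L2_set (grad_quad n A x) {..<n}"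
  have i: "integrable M ?g"
    using grad_norm_square(1) by (rule square_integrable_imp_integrable[rotated]) simp
  have "0 \<le> variance ?g" by simp
  also have "variance ?g = expectation (\<lambda>x. (?g x)\<^sup>2) - (expectation ?g)\<^sup>2"
    by (rule variance_eq[OF i grad_norm_square(1)])
  finally have "(expectation ?g)\<^sup>2 \<le> (2 * sqrt (frob n A))\<^sup>2"
    using frob_nonneg by (simp add: grad_norm_square(2) power_mult_distrib)
  then have "expectation ?g \<le> 2 * sqrt (frob n A)"
    by (rule power2_le_imp_le) (simp add: frob_nonneg)
  then show ?thesis
    by (subst nn_integral_eq_integral[OF i]) (auto intro: ennreal_leI)
qed

text \<open>
  The factor \<open>I\<close> stands for the isoperimetric constant of ellipsoids. The levels $s$ between $m - l$
  and the median $m$ have sublevel sets of measure between $1/4$ and $1/2$, so their boundary measure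
  is at least $I/4$. Integrating over these levels, with Fatou's lemma for the lower limit in the
  boundary measure, gives $I l / 4 \le \mathrm{E} |\nabla Q|$, and $l$ is comparable to the standard
  deviation.
\<close>

lemma pos_def_quad_sd:
  assumes sym: "\<And>i j. A i j = A j i" and pd: "pos_def n A"
    and I: "\<And>E. ellipsoid n E \<Longrightarrow> 0 < measure M E \<Longrightarrow> measure M E \<le> 1 / 2 \<Longrightarrow>
      I * ennreal (measure M E) \<le> boundary_measure n M E"
  shows "I * ennreal (sqrt (variance (quad n A))) \<le> ennreal (16 * 10 ^ 5 * sqrt second_moment_const * sqrt (frob n A))"
proof -
  let ?g = "\<lambda>x. L2_set (grad_quad n A x) {..<n}"
  let ?D = "\<lambda>k s. emeasure M {x\<in>space M. quad n A x - 1 / real (Suc k) * ?g x \<le> s \<and> s < quad n A x}"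
  have nonneg: "0 \<le> quad n A v" for v
  proof (cases "\<exists>i<n. v i \<noteq> 0")
    case True then show ?thesis using pd by (intro less_imp_le) auto
  next
    case False then show ?thesis by (simp add: quad_def)
  qed
  obtain m l where l: "0 \<le> l" "variance (quad n A) \<le> second_moment_const * (2 * 10 ^ 5 * l)\<^sup>2"
    and ms: "\<And>s. m - l \<le> s \<Longrightarrow> s < m \<Longrightarrow> 1 / 4 \<le> prob {x\<in>space M. quad n A x \<le> s} \<and> prob {x\<in>space M. quad n A x \<le> s} \<le> 1 / 2"
    by (rule quad_lower_deviation) (rule that)
  have bound: "I * ennreal (1 / 4) \<le> liminf (\<lambda>k. ennreal (Suc k) * ?D k s)" if s: "s \<in> {m - l<..<m}" for s
  proof -
    let ?E = "{x\<in>Rn n. quad n A x \<le> s}"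
    have p: "1 / 4 \<le> measure M ?E" "measure M ?E \<le> 1 / 2" using ms[of s] s by (auto simp: space_M)
    \<comment> \<open>A sublevel set at a still lower level is nonempty, which forces \<open>s\<close> to be positive.\<close>
    let ?s = "(m - l + s) / 2"
    have "1 / 4 \<le> prob {x\<in>space M. quad n A x \<le> ?s}" using ms[of ?s] s by auto
    then have "{x\<in>space M. quad n A x \<le> ?s} \<noteq> {}" by (metis measure_empty not_le zero_less_divide_1_iff zero_less_numeral)
    then have "0 \<le> ?s" using nonneg order_trans by blast
    then have s0: "0 < s" using s by (auto simp: field_simps)
    have "I * ennreal (1 / 4) \<le> I * ennreal (measure M ?E)" using p by (intro mult_left_mono ennreal_leI) auto
    also have "\<dots> \<le> boundary_measure n M ?E"
      using p by (intro I ellipsoid_sublevel[OF sym pd s0]) auto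
    also have "\<dots> \<le> liminf (\<lambda>k. ennreal (Suc k) * ?D k s)"
      by (rule boundary_measure_sublevel_le[OF finite_measure_axioms space_M _ _ sym nonneg]) measurable
    finally show ?thesis .
  qed
  have Dm[measurable]: "?D k \<in> borel_measurable borel" for k
    by (rule nn_integral_layer(2)[OF sigma_finite_measure_axioms]) auto
  have "I * ennreal (1 / 4) * ennreal l = (\<integral>\<^sup>+s. I * ennreal (1 / 4) * indicator {m - l<..<m} s \<partial>lborel)"
    using l(1) by (subst nn_integral_cmult) auto
  also have "\<dots> \<le> (\<integral>\<^sup>+s. liminf (\<lambda>k. ennreal (Suc k) * ?D k s) \<partial>lborel)"
    using bound by (intro nn_integral_mono) (auto simp: indicator_def)
  also have "\<dots> \<le> liminf (\<lambda>k. \<integral>\<^sup>+s. ennreal (Suc k) * ?D k s \<partial>lborel)"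
    by (intro nn_integral_liminf) measurable
  also have "\<dots> = liminf (\<lambda>k. \<integral>\<^sup>+x. ennreal (?g x) \<partial>M)"
  proof (rule arg_cong[where f = liminf], rule ext)
    fix k
    have "(\<integral>\<^sup>+s. ennreal (Suc k) * ?D k s \<partial>lborel) = ennreal (Suc k) * (\<integral>\<^sup>+s. ?D k s \<partial>lborel)"
      by (rule nn_integral_cmult) simp
    also have "(\<integral>\<^sup>+s. ?D k s \<partial>lborel) = ennreal (1 / real (Suc k)) * (\<integral>\<^sup>+x. ennreal (?g x) \<partial>M)"
      by (rule nn_integral_layer(1)[OF sigma_finite_measure_axioms]) auto
    also have "ennreal (Suc k) * (ennreal (1 / real (Suc k)) * (\<integral>\<^sup>+x. ennreal (?g x) \<partial>M)) = (\<integral>\<^sup>+x. ennreal (?g x) \<partial>M)"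
      unfolding mult.assoc[symmetric] by (subst ennreal_mult[symmetric]) auto
    finally show "(\<integral>\<^sup>+s. ennreal (Suc k) * ?D k s \<partial>lborel) = (\<integral>\<^sup>+x. ennreal (?g x) \<partial>M)" .
  qed
  also have "\<dots> = (\<integral>\<^sup>+x. ennreal (?g x) \<partial>M)" by (simp add: Liminf_const)
  also have "\<dots> \<le> ennreal (2 * sqrt (frob n A))" by (rule grad_norm_expectation)
  finally have main: "I * ennreal (1 / 4) * ennreal l \<le> ennreal (2 * sqrt (frob n A))" .
  define K where "K = 8 * 10 ^ 5 * sqrt second_moment_const"
  have K: "0 \<le> K" using second_moment_const_pos by (simp add: K_def)
  have "sqrt (variance (quad n A)) \<le> sqrt (second_moment_const * (2 * 10 ^ 5 * l)\<^sup>2)" by (rule real_sqrt_le_mono[OF l(2)])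
  also have "\<dots> = K * (1 / 4 * l)" using l(1) by (simp add: real_sqrt_mult K_def)
  finally have "I * ennreal (sqrt (variance (quad n A))) \<le> I * ennreal (K * (1 / 4 * l))"
    by (intro mult_left_mono ennreal_leI) auto
  also have "\<dots> = ennreal K * (I * ennreal (1 / 4) * ennreal l)"
  proof -
    have "ennreal (K * (1 / 4 * l)) = ennreal K * (ennreal (1 / 4) * ennreal l)"
      using K l(1) by (subst ennreal_mult, simp, simp, subst ennreal_mult) auto
    then show ?thesis by (simp only: ac_simps)
  qed
  also have "\<dots> \<le> ennreal K * ennreal (2 * sqrt (frob n A))" by (intro mult_left_mono main) auto
  also have "\<dots> = ennreal (16 * 10 ^ 5 * sqrt second_moment_const * sqrt (frob n A))"
    using K frob_nonneg by (simp add: ennreal_mult[symmetric] K_def mult.assoc mult.left_commute)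
  finally show ?thesis .
qed

end

section \<open>Comparison of the three constants\<close>

lemma square_integrable_mult:
  fixes u v :: "'a \<Rightarrow> real"
  assumes [measurable]: "u \<in> borel_measurable M" "v \<in> borel_measurable M"
    and "integrable M (\<lambda>x. (u x)\<^sup>2)" "integrable M (\<lambda>x. (v x)\<^sup>2)"
  shows "integrable M (\<lambda>x. u x * v x)"
proof (rule Bochner_Integration.integrable_bound)
  show "integrable M (\<lambda>x. (u x)\<^sup>2 + (v x)\<^sup>2)" using assms by auto
  show "AE x in M. norm (u x * v x) \<le> norm ((u x)\<^sup>2 + (v x)\<^sup>2)"
  proof (rule AE_I2)
    fix x
    have "2 * (\<bar>u x\<bar> * \<bar>v x\<bar>) \<le> (u x)\<^sup>2 + (v x)\<^sup>2"
      using zero_le_power2[of "\<bar>u x\<bar> - \<bar>v x\<bar>"] by (simp add: power2_diff)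
    moreover have "0 \<le> \<bar>u x\<bar> * \<bar>v x\<bar>" by simp
    ultimately have "\<bar>u x\<bar> * \<bar>v x\<bar> \<le> (u x)\<^sup>2 + (v x)\<^sup>2" by linarith
    then show "norm (u x * v x) \<le> norm ((u x)\<^sup>2 + (v x)\<^sup>2)" by (simp add: abs_mult)
  qed
qed measurable

text \<open>
  Half of $2 (6 + 6)$ times the constant of \<open>pos_def_quad_sd\<close>: each of the two positive definite parts
  contributes a Frobenius norm at most $6$ times that of the form itself, and
  $\mathrm{E}|\nabla Q|^2$ is $4$ times the squared Frobenius norm.
\<close>

definition poincare_const :: real where
  "poincare_const = 12 * (16 * 10 ^ 5 * sqrt second_moment_const)"

lemma poincare_const_pos: "0 < poincare_const"
  using second_moment_const_pos by (simp add: poincare_const_def)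

context isotropic_measure
begin

text \<open>
  The estimate for positive definite forms extends to all symmetric matrices, because the standard
  deviation of a difference is at most twice the sum of the standard deviations and the two parts
  have Frobenius norms controlled by that of the matrix.
\<close>

lemma quad_sd:
  assumes sym: "\<And>i j. A i j = A j i"
    and I: "\<And>E. ellipsoid n E \<Longrightarrow> 0 < measure M E \<Longrightarrow> measure M E \<le> 1 / 2 \<Longrightarrow>
      I * ennreal (measure M E) \<le> boundary_measure n M E"
  shows "I * ennreal (sqrt (variance (quad n A))) \<le> ennreal (2 * poincare_const * sqrt (frob n A))"
proof (cases "frob n A = 0")
  case True
  then have "A i j = 0" if "i < n" "j < n" for i j
    using that by (simp add: frob_def sum_nonneg_eq_0_iff sum_nonneg)
  then have "quad n A = (\<lambda>_. 0)" by (simp add: quad_def fun_eq_iff)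
  then show ?thesis by simp
next
  case False
  have "0 < frob n A" using False frob_nonneg[of n A] by simp
  obtain B C where BC: "\<And>i j. B i j = B j i" "\<And>i j. C i j = C j i" "pos_def n B" "pos_def n C"
    "\<And>i j. A i j = B i j - C i j" "frob n B \<le> 26 * frob n A" "frob n C \<le> 26 * frob n A"
    by (rule pos_def_difference[OF sym \<open>0 < frob n A\<close>]) (rule that)
  let ?k = "16 * 10 ^ 5 * sqrt second_moment_const"
  have k: "0 < ?k" using second_moment_const_pos by simp
  have root: "sqrt (frob n D) \<le> 6 * sqrt (frob n A)" if "frob n D \<le> 26 * frob n A" for D
  proof -
    have "sqrt (frob n D) \<le> sqrt (36 * frob n A)" using that frob_nonneg[of n A] by (intro real_sqrt_le_mono) linarith
    also have "\<dots> = 6 * sqrt (frob n A)" by (simp add: real_sqrt_mult)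
    finally show ?thesis .
  qed
  have bound: "I * ennreal (sqrt (variance (quad n D))) \<le> ennreal (?k * (6 * sqrt (frob n A)))"
    if "\<And>i j. D i j = D j i" "pos_def n D" "frob n D \<le> 26 * frob n A" for D
  proof -
    have "I * ennreal (sqrt (variance (quad n D))) \<le> ennreal (?k * sqrt (frob n D))"
      using that I by (intro pos_def_quad_sd)
    also have "\<dots> \<le> ennreal (?k * (6 * sqrt (frob n A)))"
      using k root[OF that(3)] by (intro ennreal_leI mult_left_mono) auto
    finally show ?thesis .
  qed
  define b where "b = expectation (quad n B)"
  define c where "c = expectation (quad n C)"
  have eq: "quad n A x = quad n B x - quad n C x" for x
    by (simp add: quad_def BC(5) left_diff_distrib sum_subtractf)
  have mean: "expectation (quad n A) = b - c"
  proof -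
    have "quad n A = (\<lambda>x. quad n B x - quad n C x)" using eq by (rule ext)
    then show ?thesis by (simp add: b_def c_def quad_integrable)
  qed
  have int: "integrable M (\<lambda>x. (quad n D x - d)\<^sup>2)" for D d
    unfolding power2_diff using quad_square_integrable quad_integrable by auto
  have "variance (quad n A) = expectation (\<lambda>x. ((quad n B x - b) - (quad n C x - c))\<^sup>2)"
    unfolding mean eq by (simp add: algebra_simps)
  also have "\<dots> \<le> expectation (\<lambda>x. 2 * (quad n B x - b)\<^sup>2 + 2 * (quad n C x - c)\<^sup>2)"
  proof (rule integral_mono')
    show "integrable M (\<lambda>x. 2 * (quad n B x - b)\<^sup>2 + 2 * (quad n C x - c)\<^sup>2)"
      using int by auto
    fix x
    have "0 \<le> ((quad n B x - b) + (quad n C x - c))\<^sup>2" by simp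
    then show "((quad n B x - b) - (quad n C x - c))\<^sup>2 \<le> 2 * (quad n B x - b)\<^sup>2 + 2 * (quad n C x - c)\<^sup>2"
      unfolding power2_diff[of "quad n B x - b"] power2_sum[of "quad n B x - b"] by linarith
  qed simp
  also have "\<dots> = 2 * variance (quad n B) + 2 * variance (quad n C)"
    using int by (simp add: b_def c_def)
  also have "\<dots> \<le> (2 * (sqrt (variance (quad n B)) + sqrt (variance (quad n C))))\<^sup>2"
  proof -
    have "0 \<le> variance (quad n B)" "0 \<le> variance (quad n C)" by simp_all
    then show ?thesis by (simp add: power_mult_distrib power2_sum)
  qed
  finally have "sqrt (variance (quad n A)) \<le> 2 * (sqrt (variance (quad n B)) + sqrt (variance (quad n C)))"
    by (rule real_le_lsqrt[rotated]) simp
  then have "I * ennreal (sqrt (variance (quad n A)))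
      \<le> I * ennreal (2 * (sqrt (variance (quad n B)) + sqrt (variance (quad n C))))"
    by (intro mult_left_mono ennreal_leI) auto
  also have "\<dots> = 2 * (I * ennreal (sqrt (variance (quad n B))) + I * ennreal (sqrt (variance (quad n C))))"
    by (simp add: ennreal_mult distrib_left mult.left_commute)
  also have "\<dots> \<le> 2 * (ennreal (?k * (6 * sqrt (frob n A))) + ennreal (?k * (6 * sqrt (frob n A))))"
    by (intro mult_left_mono add_mono bound BC) auto
  also have "\<dots> = ennreal (2 * poincare_const * sqrt (frob n A))"
  proof -
    have "ennreal (?k * (6 * sqrt (frob n A))) + ennreal (?k * (6 * sqrt (frob n A))) = ennreal (2 * (?k * (6 * sqrt (frob n A))))"
      using k frob_nonneg by (subst ennreal_plus[symmetric]) auto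
    then have "2 * (ennreal (?k * (6 * sqrt (frob n A))) + ennreal (?k * (6 * sqrt (frob n A)))) = ennreal (2 * (2 * (?k * (6 * sqrt (frob n A)))))"
      using k frob_nonneg by (simp only:) (subst ennreal_mult, auto)
    then show ?thesis by (simp add: poincare_const_def mult.assoc)
  qed
  finally show ?thesis .
qed

lemma grad_norm_quadratic_form:
  assumes "\<And>i j. A i j = A j i" "\<And>x. x \<in> Rn n \<Longrightarrow> Q x = quad n A x"
  shows "expectation (\<lambda>x. (L2_set (gradient Q x) {..<n})\<^sup>2) = 4 * frob n A"
proof -
  have "expectation (\<lambda>x. (L2_set (gradient Q x) {..<n})\<^sup>2) = expectation (\<lambda>x. (L2_set (grad_quad n A x) {..<n})\<^sup>2)"
    using L2_set_gradient[OF assms] by (intro Bochner_Integration.integral_cong refl) (simp add: space_M)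
  then show ?thesis by (simp add: grad_norm_square)
qed

lemma variance_ratio_le:
  assumes Q: "quadratic_form n Q"
    and I: "\<And>E. ellipsoid n E \<Longrightarrow> 0 < measure M E \<Longrightarrow> measure M E \<le> 1 / 2 \<Longrightarrow>
      I * ennreal (measure M E) \<le> boundary_measure n M E"
  shows "I * ennreal (sqrt (variance Q / expectation (\<lambda>x. (L2_set (gradient Q x) {..<n})\<^sup>2)))
    \<le> ennreal poincare_const"
proof -
  obtain A0 where A0: "\<And>x. x \<in> Rn n \<Longrightarrow> Q x = quad n A0 x"
    using Q by (auto simp: quadratic_form_def quad_def)
  define A where "A i j = (A0 i j + A0 j i) / 2" for i j
  have sym: "A i j = A j i" for i j by (simp add: A_def)
  have QA: "Q x = quad n A x" if "x \<in> Rn n" for x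
  proof -
    have "(\<Sum>i<n. \<Sum>j<n. A0 j i * x i * x j) = quad n A0 x"
      unfolding quad_def by (subst sum.swap, intro sum.cong refl) (simp only: ac_simps)
    then have "quad n A0 x = ((\<Sum>i<n. \<Sum>j<n. A0 i j * x i * x j) + (\<Sum>i<n. \<Sum>j<n. A0 j i * x i * x j)) / 2"
      by (simp add: quad_def)
    also have "\<dots> = quad n A x"
      unfolding quad_def A_def sum.distrib[symmetric] sum_divide_distrib
      by (intro sum.cong refl) (simp add: algebra_simps add_divide_distrib)
    finally show ?thesis using A0[OF that] by simp
  qed
  have var: "variance Q = variance (quad n A)"
  proof -
    have "expectation Q = expectation (quad n A)"
      using QA by (intro Bochner_Integration.integral_cong refl) (simp add: space_M)
    then show ?thesis using QA by (intro Bochner_Integration.integral_cong refl) (simp add: space_M)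
  qed
  have grad: "expectation (\<lambda>x. (L2_set (gradient Q x) {..<n})\<^sup>2) = 4 * frob n A"
    by (rule grad_norm_quadratic_form[OF sym QA])
  show ?thesis
  proof (cases "frob n A = 0")
    case True then show ?thesis by (simp add: grad)
  next
    case False
    then have f: "0 < sqrt (frob n A)" using frob_nonneg[of n A] by simp
    have "I * ennreal (sqrt (variance (quad n A) / (4 * frob n A)))
        = I * ennreal (sqrt (variance (quad n A))) * ennreal (1 / (2 * sqrt (frob n A)))"
      using f by (simp add: real_sqrt_divide real_sqrt_mult mult.assoc ennreal_mult[symmetric])
    also have "\<dots> \<le> ennreal (2 * poincare_const * sqrt (frob n A)) * ennreal (1 / (2 * sqrt (frob n A)))"
      by (intro mult_right_mono quad_sd sym I) auto
    also have "\<dots> = ennreal poincare_const"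
      using f poincare_const_pos by (subst ennreal_mult[symmetric]) auto
    finally show ?thesis by (simp only: var grad)
  qed
qed

text \<open>
  With $\ell = \langle X, \theta \rangle$, the definition of $A$ makes $\mathrm{E}[Q_A(X)\, \ell]$ equal
  to $S = \sum_{i,j} A_{ij}^2$. As $\ell$ is centered with variance $1$, the variance of
  $Q_A(X) - S \ell$ is $\mathrm{Var}[Q_A(X)] - S^2$.
\<close>

lemma third_moment_le:
  assumes th: "\<theta> \<in> sphere_Rn n"
  defines "A \<equiv> \<lambda>i j. expectation (\<lambda>x. x i * x j * inner_Rn n x \<theta>)"
  shows "(frob n A)\<^sup>2 \<le> variance (quad n A)"
proof -
  define l where "l x = inner_Rn n x \<theta>" for x
  have l_sum: "l x = (\<Sum>i<n. \<theta> i * x i)" for x by (simp add: l_def inner_Rn_def mult.commute)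
  have lm[measurable]: "l \<in> borel_measurable M" unfolding l_sum[abs_def] by measurable
  have l2: "(l x)\<^sup>2 = quad n (\<lambda>i j. \<theta> i * \<theta> j) x" for x by (simp add: l_sum linear_square)
  have l2int: "integrable M (\<lambda>x. (l x)\<^sup>2)" unfolding l2 by (rule quad_integrable)
  have "(\<Sum>i<n. (\<theta> i)\<^sup>2) = 1" using th by (simp add: sphere_Rn_def L2_set_def)
  then have El2: "expectation (\<lambda>x. (l x)\<^sup>2) = 1"
    unfolding l2 quad_expectation by (simp add: power2_eq_square)
  have lint: "integrable M l"
    using l2int by (rule square_integrable_imp_integrable[rotated]) simp
  have El: "expectation l = 0"
  proof -
    have "expectation l = (\<Sum>i<n. expectation (\<lambda>x. \<theta> i * x i))"
      unfolding l_sum by (intro Bochner_Integration.integral_sum integrable_mult_right coord_integrable) auto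
    then show ?thesis by (simp add: coord_expectation)
  qed
  have Qlint: "integrable M (\<lambda>x. quad n B x * l x)" for B
    by (intro square_integrable_mult quad_square_integrable l2int) measurable
  have xxl: "integrable M (\<lambda>x. x i * x j * l x)" if "i < n" "j < n" for i j
    using Qlint[of "\<lambda>a b. if a = i \<and> b = j then 1 else 0"] that by (simp add: quad_unit)
  have "expectation (\<lambda>x. quad n A x * l x) = (\<Sum>i<n. expectation (\<lambda>x. \<Sum>j<n. A i j * (x i * x j * l x)))"
    unfolding quad_def sum_distrib_right mult.assoc
    by (intro Bochner_Integration.integral_sum Bochner_Integration.integrable_sum integrable_mult_right)
       (use xxl in \<open>auto simp: mult.assoc\<close>)
  also have "\<dots> = (\<Sum>i<n. \<Sum>j<n. expectation (\<lambda>x. A i j * (x i * x j * l x)))"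
    by (intro sum.cong refl Bochner_Integration.integral_sum integrable_mult_right xxl) auto
  also have "\<dots> = frob n A"
    by (simp add: frob_def A_def l_def power2_eq_square)
  finally have S: "expectation (\<lambda>x. quad n A x * l x) = frob n A" .
  define S where "S = frob n A"
  define \<mu> where "\<mu> = expectation (quad n A)"
  have int: "integrable M (\<lambda>x. (quad n A x - \<mu>)\<^sup>2)"
    unfolding power2_diff using quad_square_integrable quad_integrable by auto
  have "0 \<le> expectation (\<lambda>x. ((quad n A x - \<mu>) - S * l x)\<^sup>2)" by simp
  also have "\<dots> = expectation (\<lambda>x. (quad n A x - \<mu>)\<^sup>2 - (2 * S) * (quad n A x * l x) + (2 * S * \<mu>) * l x + S\<^sup>2 * (l x)\<^sup>2)"
    by (intro Bochner_Integration.integral_cong refl) (simp add: power2_eq_square algebra_simps)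
  also have "\<dots> = variance (quad n A) - (2 * S) * S + S\<^sup>2"
    using int Qlint[of A] lint l2int by (simp add: S El El2 S_def[symmetric] \<mu>_def)
  finally show ?thesis by (simp add: S_def power2_eq_square)
qed

end

lemma isotropic_log_concave_measure:
  assumes "M \<in> isotropic_log_concave n"
  obtains \<rho> where "isotropic_measure M n \<rho>"
proof -
  obtain H where P: "prob_space M" and Hm: "H \<in> borel_measurable (lebesgue_Rn n)" and H: "convex_Rn n H"
    and M: "M = density (lebesgue_Rn n) (\<lambda>x. exp_uminus (H x))" and iso: "isotropic n M"
    using assms by (auto simp: isotropic_log_concave_def log_concave_def)
  define \<rho> where "\<rho> x = (if H x = \<infinity> then 0 else exp (- real_of_ereal (H x)))" for x
  have [measurable]: "H \<in> borel_measurable (leb {..<n})" using Hm by (simp add: lebesgue_Rn_def)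
  have "isotropic_measure M n \<rho>"
  proof (intro isotropic_measure.intro log_concave_measure.intro P
      log_concave_measure_axioms.intro isotropic_measure_axioms.intro iso)
    show "\<rho> \<in> borel_measurable (leb {..<n})" unfolding \<rho>_def by measurable
    show "0 \<le> \<rho> x" for x by (simp add: \<rho>_def)
    show "M = density (leb {..<n}) (\<lambda>x. ennreal (\<rho> x))"
      unfolding M lebesgue_Rn_def by (rule arg_cong[where f = "density _"]) (auto simp: exp_uminus_def \<rho>_def)
    fix x y t
    assume xy: "x \<in> Rn n" "y \<in> Rn n" and pos: "0 < \<rho> x" "0 < \<rho> y" and t: "0 < t" "t < (1::real)"
    have z: "mix {..<n} t x y \<in> Rn n" by (auto simp: mix_def Rn_def)
    have fin: "H x \<noteq> -\<infinity>" "H y \<noteq> -\<infinity>" "H (mix {..<n} t x y) \<noteq> -\<infinity>"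
      using H xy z by (auto simp: convex_Rn_def)
    obtain a b where ab: "H x = ereal a" "H y = ereal b"
      using pos fin by (cases "H x"; cases "H y") (auto simp: \<rho>_def split: if_splits)
    have "H (mix {..<n} t x y) \<le> ereal (1 - t) * H x + ereal t * H y"
      using H xy t by (auto simp: convex_Rn_def mix_def)
    then have "H (mix {..<n} t x y) \<le> ereal ((1 - t) * a + t * b)" by (simp add: ab)
    then obtain c where c: "H (mix {..<n} t x y) = ereal c" "c \<le> (1 - t) * a + t * b"
      using fin(3) by (cases "H (mix {..<n} t x y)") auto
    have "\<rho> x powr (1 - t) * \<rho> y powr t = exp (- ((1 - t) * a + t * b))"
      by (simp add: \<rho>_def ab powr_def exp_add[symmetric] algebra_simps)
    also have "\<dots> \<le> exp (- c)" using c(2) by simp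
    also have "\<dots> = \<rho> (mix {..<n} t x y)" by (simp add: \<rho>_def c)
    finally show "\<rho> x powr (1 - t) * \<rho> y powr t \<le> \<rho> (mix {..<n} t x y)" .
  qed
  then show thesis by (rule that)
qed

lemma ennreal_sqrt_le:
  assumes "x \<le> ennreal (c\<^sup>2) * y" "0 < c"
  shows "ennreal_sqrt x \<le> ennreal c * ennreal_sqrt y"
proof (cases y)
  case top
  then show ?thesis using assms(2) by (simp add: ennreal_sqrt_def ennreal_mult_top)
next
  case (real r)
  then have "x \<le> ennreal (c\<^sup>2 * r)" using assms by (simp add: ennreal_mult)
  then obtain s where s: "x = ennreal s" "0 \<le> s" "s \<le> c\<^sup>2 * r"
    using real by (cases x) (auto simp: ennreal_le_iff top_unique)
  then have "sqrt s \<le> sqrt (c\<^sup>2 * r)" by simp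
  then have "sqrt s \<le> c * sqrt r" using assms(2) by (simp add: real_sqrt_mult)
  then show ?thesis using s real assms(2) by (simp add: ennreal_sqrt_def ennreal_mult[symmetric] ennreal_leI)
qed

text \<open>
  The form built from the third moments is itself a competitor for \<open>Q_const\<close>: its ratio is
  $\mathrm{Var}[Q_A] / (4 S) \ge S / 4$.
\<close>

lemma K_const_le: "K_const n \<le> ennreal 2 * Q_const n"
  unfolding K_const_def Q_const_def
proof (intro ennreal_sqrt_le SUP_least)
  fix M \<theta> assume M: "M \<in> isotropic_log_concave n" and th: "\<theta> \<in> sphere_Rn n"
  obtain \<rho> where "isotropic_measure M n \<rho>" using isotropic_log_concave_measure[OF M] by blast
  then interpret isotropic_measure M n \<rho> .
  let ?r = "\<lambda>Q. variance Q / expectation (\<lambda>x. (L2_set (gradient Q x) {..<n})\<^sup>2)"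
  let ?Q = "{Q. quadratic_form n Q \<and> (\<exists>x\<in>Rn n. Q x \<noteq> 0)}"
  define A where "A i j = expectation (\<lambda>x. x i * x j * inner_Rn n x \<theta>)" for i j
  have S2: "(frob n A)\<^sup>2 \<le> variance (quad n A)"
    unfolding A_def by (rule third_moment_le[OF th])
  have S: "(\<Sum>i<n. \<Sum>j<n. (expectation (\<lambda>x. x i * x j * inner_Rn n x \<theta>))\<^sup>2) = frob n A"
    by (simp add: frob_def A_def)
  have "ennreal (frob n A) \<le> ennreal (2\<^sup>2) * (SUP M\<in>isotropic_log_concave n. SUP Q\<in>?Q.
        ennreal (prob_space.variance M Q / prob_space.expectation M (\<lambda>x. (L2_set (gradient Q x) {..<n})\<^sup>2)))"
  proof (cases "frob n A = 0")
    case True then show ?thesis by simp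
  next
    case False
    then have pos: "0 < frob n A" using frob_nonneg[of n A] by simp
    have sym: "A i j = A j i" for i j by (simp add: A_def mult.commute[of "_ i"])
    have "quad n A \<in> ?Q"
    proof -
      have "\<exists>x\<in>Rn n. quad n A x \<noteq> 0"
      proof (rule ccontr)
        assume "\<not> (\<exists>x\<in>Rn n. quad n A x \<noteq> 0)"
        then have z: "quad n A x = 0" if "x \<in> space M" for x using that by (simp add: space_M)
        then have "expectation (quad n A) = expectation (\<lambda>_. 0)"
          by (intro Bochner_Integration.integral_cong refl)
        then have "variance (quad n A) = expectation (\<lambda>_. 0)"
          using z by (intro Bochner_Integration.integral_cong refl) simp
        then have "(frob n A)\<^sup>2 \<le> 0" using S2 by simp
        then show False using pos by simp
      qed
      then show ?thesis by (auto simp: quadratic_form_def quad_def)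
    qed
    then have "ennreal (?r (quad n A)) \<le> (SUP M\<in>isotropic_log_concave n. SUP Q\<in>?Q.
        ennreal (prob_space.variance M Q / prob_space.expectation M (\<lambda>x. (L2_set (gradient Q x) {..<n})\<^sup>2)))"
      by (intro SUP_upper2[OF M] SUP_upper)
    moreover have "frob n A \<le> 2\<^sup>2 * ?r (quad n A)"
    proof -
      have "frob n A \<le> variance (quad n A) / frob n A"
        using S2 pos unfolding power2_eq_square[of "frob n A"] by (simp only: pos_le_divide_eq)
      also have "\<dots> = 2\<^sup>2 * ?r (quad n A)"
        unfolding grad_norm_quadratic_form[OF sym refl] by simp
      finally show ?thesis .
    qed
    then have "ennreal (frob n A) \<le> ennreal (2\<^sup>2) * ennreal (?r (quad n A))"
      using pos frob_nonneg by (subst ennreal_mult[symmetric]) (auto intro!: ennreal_leI)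
    ultimately show ?thesis by (meson mult_left_mono order_trans zero_le)
  qed
  then show "ennreal (\<Sum>i<n. \<Sum>j<n. (expectation (\<lambda>x. x i * x j * inner_Rn n x \<theta>))\<^sup>2)
    \<le> ennreal (2\<^sup>2) * (SUP M\<in>isotropic_log_concave n. SUP Q\<in>?Q.
        ennreal (prob_space.variance M Q / prob_space.expectation M (\<lambda>x. (L2_set (gradient Q x) {..<n})\<^sup>2)))"
    unfolding S .
qed simp

lemma Q_const_le: "Q_const n \<le> ennreal poincare_const * R_const n"
proof -
  let ?Q = "{Q. quadratic_form n Q \<and> (\<exists>x\<in>Rn n. Q x \<noteq> 0)}"
  let ?r = "\<lambda>M Q. prob_space.variance M Q / prob_space.expectation M (\<lambda>x. (L2_set (gradient Q x) {..<n})\<^sup>2)"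
  define I where "I = (INF M\<in>isotropic_log_concave n. INF E\<in>{E. ellipsoid n E \<and> 0 < measure M E \<and> measure M E \<le> 1/2}.
        boundary_measure n M E / ennreal (measure M E))"
  have R: "R_const n = inverse I" by (simp add: R_const_def I_def)
  have main: "I * ennreal (sqrt (?r M Q)) \<le> ennreal poincare_const"
    if M: "M \<in> isotropic_log_concave n" and Q: "Q \<in> ?Q" for M Q
  proof -
    obtain \<rho> where "isotropic_measure M n \<rho>" using isotropic_log_concave_measure[OF M] by blast
    then interpret isotropic_measure M n \<rho> .
    show ?thesis
    proof (rule variance_ratio_le)
      show "quadratic_form n Q" using Q by simp
      fix E assume E: "ellipsoid n E" "0 < measure M E" "measure M E \<le> 1 / 2"
      have "I \<le> boundary_measure n M E / ennreal (measure M E)"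
        unfolding I_def using E by (intro INF_lower2[OF M] INF_lower) auto
      then have "I * ennreal (measure M E) \<le> boundary_measure n M E / ennreal (measure M E) * ennreal (measure M E)"
        by (intro mult_right_mono) auto
      also have "\<dots> = boundary_measure n M E"
        using E(2) by (simp add: ennreal_divide_times ennreal_divide_self)
      finally show "I * ennreal (measure M E) \<le> boundary_measure n M E" .
    qed
  qed
  \<comment> \<open>For \<open>I = 0\<close> the bound is infinite; for \<open>I = \<infinity>\<close> all variance ratios must vanish.\<close>
  consider "I = 0" | "I = \<infinity>" | i where "I = ennreal i" "0 < i"
    by (cases I) (auto simp: less_le)
  then show ?thesis
  proof cases
    case 1
    then show ?thesis using poincare_const_pos by (simp add: R ennreal_mult_top)
  next
    case 2
    have "ennreal (?r M Q) \<le> 0" if "M \<in> isotropic_log_concave n" "Q \<in> ?Q" for M Q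
    proof -
      have "ennreal (sqrt (?r M Q)) = 0"
        using main[OF that] 2 by (auto simp: ennreal_top_mult top_unique split: if_splits)
      then show ?thesis by (simp add: ennreal_eq_0_iff)
    qed
    then have "(SUP M\<in>isotropic_log_concave n. SUP Q\<in>?Q. ennreal (?r M Q)) \<le> 0"
      by (intro SUP_least)
    then show ?thesis by (simp add: Q_const_def ennreal_sqrt_def)
  next
    case (3 i)
    have "ennreal (?r M Q) \<le> ennreal ((poincare_const / i)\<^sup>2) * 1" if "M \<in> isotropic_log_concave n" "Q \<in> ?Q" for M Q
    proof (cases "0 \<le> ?r M Q")
      case True
      have "ennreal (i * sqrt (?r M Q)) \<le> ennreal poincare_const"
        using main[OF that] 3 True by (simp add: ennreal_mult)
      then have "sqrt (?r M Q) \<le> poincare_const / i"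
        using 3 poincare_const_pos by (simp add: ennreal_le_iff field_simps)
      then have "(sqrt (?r M Q))\<^sup>2 \<le> (poincare_const / i)\<^sup>2" using True by (intro power_mono) auto
      then show ?thesis using True by (simp add: ennreal_leI)
    next
      case False then show ?thesis by (simp add: ennreal_neg)
    qed
    then have "Q_const n \<le> ennreal (poincare_const / i) * ennreal_sqrt 1"
      unfolding Q_const_def using 3 poincare_const_pos by (intro ennreal_sqrt_le SUP_least) auto
    also have "\<dots> = ennreal poincare_const * R_const n"
      using 3 poincare_const_pos by (simp add: R ennreal_sqrt_def inverse_ennreal ennreal_mult[symmetric] divide_inverse)
    finally show ?thesis .
  qed
qed

theorem fact6p1:
  shows "\<exists>C\<^sub>1 C\<^sub>2 :: real. C\<^sub>1 > 0 \<and> C\<^sub>2 > 0 \<and>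
    (\<forall>n::nat. n \<ge> 1 \<longrightarrow>
       K_const n \<le> ennreal C\<^sub>1 * Q_const n \<and>
       ennreal C\<^sub>1 * Q_const n \<le> ennreal C\<^sub>2 * R_const n)"
proof (intro exI conjI allI impI)
  fix n :: nat
  show "K_const n \<le> ennreal 2 * Q_const n" by (rule K_const_le)
  have "ennreal 2 * Q_const n \<le> ennreal 2 * (ennreal poincare_const * R_const n)"
    by (intro mult_left_mono Q_const_le) simp
  then show "ennreal 2 * Q_const n \<le> ennreal (2 * poincare_const) * R_const n"
    using poincare_const_pos by (simp add: ennreal_mult mult.assoc)
qed (use poincare_const_pos in auto)

end
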